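(* Consider a stagewise independent multistage stochastic program with the regularization, standing assumptions and deterministic sampling dual dynamic programming algorithm described in the context. For $0\le t\le T-1$ let $D_t$ be the diameter of the smallest ball (in the norm $\|\cdot\|$) containing $\mathcal X_t$, and let $L,d,D$ be upper bounds for $L_t$, $d_t$ and $D_t$ respectively, $0\le t\le T-1$. Let $\epsilon>0$. If the algorithm with tolerance $\epsilon$ terminates with an $\epsilon$-optimal root node solution $(x_0^*,y_0^* )$, then the iteration index $i$ at termination satisfies $$i\le T\left(1+\frac{2LDT}{\epsilon}\right)^d.$$
   Context: **Problem.** $T\ge1$. For each stage $t=1,\dots,T$ there is a finite set $\tilde{\mathcal N}(t)$ of distinct nodes; $\tilde{\mathcal N}(0)=\{r\}$. Node $m\in\tilde{\mathcal N}(t)$, $t\ge1$, is realized with probability $p_{t-1,m}>0$ independently of the past, $\sum_{m\in\tilde{\mathcal N}(t)}p_{t-1,m}=1$. Each node $m\in\tilde{\mathcal N}(t)$ has a compact set $\mathcal F_m$ of pairs $(x,y)$ in a Euclidean space, and for $t\le T-1$ its projection onto the $x$-coordinates is the same set $\mathcal X_t\subset\mathbb R^{d_t}$ for all $m\in\tilde{\mathcal N}(t)$; $\mathcal X_{-1}=\{0\}$ and $x_{-1}=0$. The cost $f_m(z,y,x)\in[0,+\infty]$, defined for $z\in\mathcal X_{t-1}$, $(x,y)\in\mathcal F_m$, is lower semicontinuous. The scenario tree has as stage-$t$ nodes the sequences $n=(n_1,\dots,n_t)$, $n_s\in\tilde{\mathcal N}(s)$ (the root being the empty sequence), with the data of $n_t$,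 probability $p_n=\prod_{s\le t}p_{s-1,n_s}$ and parent $a(n)=(n_1,\dots,n_{t-1})$; the original problem is to minimize $\sum_n p_nf_n(x_{a(n)},y_n,x_n)$ over $(x_n,y_n)\in\mathcal F_n$ for all tree nodes $n$, and it is assumed to have a feasible solution with finite objective. Fix a norm $\|\cdot\|$ with dual norm $\|\cdot\|_*$. **Regularization.** A penalty function is $\psi:\mathbb R^d\to\mathbb R_+$ with $\psi(x)=0$ iff $x=0$ and with the diameter of $\{\psi\le a\}$ tending to $0$ as $a\to0$. For each $m\in\tilde{\mathcal N}(t)$ a penalty function $\psi_m$, 1-Lipschitz on $\mathcal X_{t-1}-\mathcal X_{t-1}$, and $\sigma_m>0$ are given. With $\mathcal Q_T^{\mathrm R}\equiv0$ and $\mathcal Q_t^{\mathrm R}(x)=\sum_{m\in\tilde{\mathcal N}(t+1)}p_{t,m}Q_m^{\mathrm R}(x)$ for $t<T$, define for $m\in\tilde{\mathcal N}(t)$ $$Q_m^{\mathrm R}(x_{t-1})=\min_{(x,y)\in\mathcal F_m,\ z\in\mathcal X_{t-1}}\{f_m(z,y,x)+\sigma_m\psi_m(x_{t-1}-z)+\mathcal Q_t^{\mathrm R}(x)\}.$$ $v^{\mathrm{reg}}=\min_{(x,y)\in\mathcal F_r}\{f_r(0,y,x)+\mathcal Q_0^{\mathrm R}(x)\}$; $(x_0,y_0)\in\mathcal F_r$ is an $\epsilon$-optimal root node solution if $f_r(0,y_0,x_0)+\mathcal Q_0^{\mathrm R}(x_0)\le v^{\mathrm{reg}}+\epsilon$.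 Standing assumption (exactness): every optimal solution of the problem of minimizing $\sum_n p_n(f_n(z_n,y_n,x_n)+\sigma_n\psi_n(x_{a(n)}-z_n))$ over $(x_n,y_n)\in\mathcal F_n$, $z_n\in\mathcal X_{t(n)-1}$ for all scenario tree nodes $n$ (where $t(n)$ is the stage of $n$) satisfies $z_n=x_{a(n)}$ for all $n$. The problem is called convex if all $\mathcal F_m,f_m,\psi_m$ are convex. For $m\neq r$ let $\mathcal U_m=\{(\lambda,\rho):\|\lambda\|_*\le l_{m,\lambda},\ 0\le\rho\le l_{m,\rho}\}$ with given nonnegative bounds satisfying $l_{m,\lambda}\ge\sigma_m,\ l_{m,\rho}=0$ in the convex case with $\psi_m=\|\cdot\|$, and $l_{m,\rho}\ge\sigma_m$ otherwise. Put $L_t=\sum_{m\in\tilde{\mathcal N}(t+1)}p_{t,m}(l_{m,\lambda}+l_{m,\rho})$ for $0\le t\le T-1$. **Deterministic sampling algorithm with tolerance $\epsilon$.** "An optimal solution" means any optimal solution returned by a given oracle. Initialize $\underline{\mathcal Q}_t^0\equiv0$ for all $t$, $\overline{\mathcal Q}_t^0\equiv+\infty$ for $t\le T-1$, and $\underline{\mathcal Q}_T^i\equiv\overline{\mathcal Q}_T^i\equiv0$ for all $i$. Let $(x_0^1,y_0^1)$ be an optimal solution of $\min_{(x,y)\in\mathcal F_r}f_r(0,y,x)$, $\mathrm{LB}=f_r(0,y_0^1,x_0^1)$, $\mathrm{UB}=+\infty$. For $i=1,2,\dots$, while $\mathrm{UB}-\mathrm{LB}>\epsilon$, iteration $i$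 is: (Forward) for $t=1,\dots,T$: for each $n\in\tilde{\mathcal N}(t)$, $(x_n^i,y_n^i,z_n^i)$ is an optimal solution of $\min_{(x,y)\in\mathcal F_n,z\in\mathcal X_{t-1}}\{f_n(z,y,x)+\sigma_n\psi_n(x_{t-1}^i-z)+\underline{\mathcal Q}_t^{i-1}(x)\}$; if $t\le T-1$, let $\gamma_n^i=\overline{\mathcal Q}_t^{i-1}(x_n^i)-\underline{\mathcal Q}_t^{i-1}(x_n^i)$, select any $n^*\in\tilde{\mathcal N}(t)$ with $\gamma_{n^*}^i\ge\gamma_n^i$ for all $n\in\tilde{\mathcal N}(t)$, and set $x_t^i=x_{n^*}^i$. (Backward) for $t=T,\dots,1$: if $t<T$, set $\underline{\mathcal Q}_t^i(x)=\max\{\underline{\mathcal Q}_t^{i-1}(x),\sum_{m\in\tilde{\mathcal N}(t+1)}p_{t,m}C_m^i(x)\}$ and let $\overline{\mathcal Q}_t^i$ be $\mathrm{conv}\{\overline{\mathcal Q}_t^{i-1},h_t^i\}$ in the convex case and $\min\{\overline{\mathcal Q}_t^{i-1},h_t^i\}$ otherwise, where $h_t^i(x)=\sum_{m\in\tilde{\mathcal N}(t+1)}p_{t,m}(\bar v_m^i+\sigma_m\|x-x_t^i\|)$ and $\mathrm{conv}\{f,g\}$ is the convex biconjugate of $\min\{f,g\}$ on $\mathbb R^{d_t}$. Then for each $n\in\tilde{\mathcal N}(t)$ let $\underline v_n^i$ be the optimal value and $(\hat\lambda_n^i,\hat\rho_n^i)$ an optimal outer solution of $\max_{(\lambda,\rho)\in\mathcal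 U_n}\min_{(x,y)\in\mathcal F_n,z\in\mathcal X_{t-1}}\{f_n(z,y,x)+\langle\lambda,x_{t-1}^i-z\rangle+\rho\psi_n(x_{t-1}^i-z)+\underline{\mathcal Q}_t^i(x)\}$; set $C_n^i(x)=-\langle\hat\lambda_n^i,x_{t-1}^i-x\rangle-\hat\rho_n^i\psi_n(x_{t-1}^i-x)+\underline v_n^i$ and $\bar v_n^i=f_n(z_n^i,y_n^i,x_n^i)+\sigma_n\psi_n(x_{t-1}^i-z_n^i)+\overline{\mathcal Q}_t^i(x_n^i)$. (Root) update $\underline{\mathcal Q}_0^i,\overline{\mathcal Q}_0^i$ by the same formulas with $t=0$; let $(x_0^{i+1},y_0^{i+1})$ be an optimal solution of $\min_{(x,y)\in\mathcal F_r}\{f_r(0,y,x)+\underline{\mathcal Q}_0^i(x)\}$; set $\mathrm{LB}=f_r(0,y_0^{i+1},x_0^{i+1})+\underline{\mathcal Q}_0^i(x_0^{i+1})$; if $\mathrm{UB}>f_r(0,y_0^{i+1},x_0^{i+1})+\overline{\mathcal Q}_0^i(x_0^{i+1})$, set $\mathrm{UB}$ to this value and $(x_0^*,y_0^* )=(x_0^{i+1},y_0^{i+1})$. *)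

theory Defs
  imports "HOL-Analysis.Analysis"
begin

section \<open>Norms, semicontinuity and convexity\<close>

definition is_norm :: "('a::real_vector \<Rightarrow> real) \<Rightarrow> bool" where
  "is_norm nu \<longleftrightarrow>
     (\<forall>x. 0 \<le> nu x) \<and> (\<forall>x. nu x = 0 \<longleftrightarrow> x = 0) \<and>
     (\<forall>c x. nu (c *\<^sub>R x) = \<bar>c\<bar> * nu x) \<and> (\<forall>x y. nu (x + y) \<le> nu x + nu y)"

text \<open>Dual norm on the subspace \<open>V\<close>, that is, with respect to \<open>nu\<close> restricted to \<open>V\<close>.\<close>

definition dual_norm :: "'a::real_inner set \<Rightarrow> ('a \<Rightarrow> real) \<Rightarrow> 'a \<Rightarrow> real" where
  "dual_norm V nu l = Sup {l \<bullet> x | x. x \<in> V \<and> nu x \<le> 1}"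

text \<open>Extended-valued, hence \<open>\<infinity>\<close> for unbounded sets (the library's \<open>diameter\<close> is 0 there).\<close>

definition nu_diameter :: "('a::real_vector \<Rightarrow> real) \<Rightarrow> 'a set \<Rightarrow> ereal" where
  "nu_diameter nu S = (SUP (x, y)\<in>S \<times> S. ereal (nu (x - y)))"

text \<open>Diameter of the smallest \<open>nu\<close>-ball of \<open>V\<close> containing \<open>S\<close>; the infimum over the radii is
  attained when \<open>S\<close> is nonempty and compact.\<close>

definition enclosing_diameter :: "'a::real_vector set \<Rightarrow> ('a \<Rightarrow> real) \<Rightarrow> 'a set \<Rightarrow> real" where
  "enclosing_diameter V nu S = Inf {2 * r | r. 0 \<le> r \<and> (\<exists>c\<in>V. S \<subseteq> {x \<in> V. nu (x - c) \<le> r})}"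

definition lsc_on :: "'a::topological_space set \<Rightarrow> ('a \<Rightarrow> ereal) \<Rightarrow> bool" where
  "lsc_on S g \<longleftrightarrow> (\<forall>x\<in>S. g x \<le> Liminf (at x within S) g)"

definition econvex_on :: "'a::real_vector set \<Rightarrow> ('a \<Rightarrow> ereal) \<Rightarrow> bool" where
  "econvex_on S g \<longleftrightarrow> convex S \<and>
     (\<forall>a\<in>S. \<forall>b\<in>S. \<forall>u\<ge>0. \<forall>v\<ge>0. u + v = 1 \<longrightarrow>
        g (u *\<^sub>R a + v *\<^sub>R b) \<le> ereal u * g a + ereal v * g b)"

definition conjugate :: "'a::real_inner set \<Rightarrow> ('a \<Rightarrow> ereal) \<Rightarrow> 'a \<Rightarrow> ereal" where
  "conjugate V g s = (SUP x\<in>V. ereal (s \<bullet> x) - g x)"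

text \<open>\<open>conv {g, h}\<close>: the biconjugate of \<open>min {g, h}\<close>, both functions being considered on \<open>V\<close>.\<close>

definition conv_env ::
    "'a::real_inner set \<Rightarrow> ('a \<Rightarrow> ereal) \<Rightarrow> ('a \<Rightarrow> ereal) \<Rightarrow> 'a \<Rightarrow> ereal" where
  "conv_env V g h = conjugate V (conjugate V (\<lambda>x. min (g x) (h x)))"

definition penalty_on :: "'a::real_vector set \<Rightarrow> ('a \<Rightarrow> real) \<Rightarrow> ('a \<Rightarrow> real) \<Rightarrow> bool" where
  "penalty_on V nu psi \<longleftrightarrow>
     (\<forall>x\<in>V. 0 \<le> psi x) \<and> (\<forall>x\<in>V. psi x = 0 \<longleftrightarrow> x = 0) \<and>
     ((\<lambda>a. nu_diameter nu {x \<in> V. psi x \<le> a}) \<longlongrightarrow> 0) (at_right 0)"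


section \<open>Problem data\<close>

text \<open>The state dimensions \<open>d\<^sub>t\<close> vary with the stage. The space \<open>\<real>\<^bsup>d\<^sub>t\<^esup>\<close> is the coordinate
  subspace of \<^typ>\<open>real^'n\<close> given by a set \<open>coords P t\<close> of \<open>d\<^sub>t\<close> coordinates; \<^typ>\<open>'n\<close> is
  arbitrary, so every finite family of dimensions occurs. The coordinate sets of different stages
  may be disjoint, so restricting the one norm \<open>nrm P\<close> to these subspaces allows any choice of a
  norm on each of them. The local variables \<open>y\<close> of all nodes live in one Euclidean
  space \<^typ>\<open>'y\<close>.

  Nodes of different stages are distinct, so that node data is indexed by the node only.
  \<open>prob P t m\<close> is \<open>p\<^bsub>t,m\<^esub>\<close> for a node \<open>m\<close> of stage \<open>t + 1\<close>, and \<open>cost P m z y x\<close>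
  is \<open>f\<^sub>m(z, y, x)\<close>.\<close>

record ('m, 'n, 'y) msp =
  horizon :: nat
  nodes :: "nat \<Rightarrow> 'm set"
  rootnode :: 'm
  prob :: "nat \<Rightarrow> 'm \<Rightarrow> real"
  coords :: "nat \<Rightarrow> ('n::finite) set"
  states :: "nat \<Rightarrow> (real^'n) set"
  feas :: "'m \<Rightarrow> ((real^'n) \<times> 'y) set"
  cost :: "'m \<Rightarrow> real^'n \<Rightarrow> 'y \<Rightarrow> real^'n \<Rightarrow> ereal"
  nrm :: "real^'n \<Rightarrow> real"
  pen :: "'m \<Rightarrow> real^'n \<Rightarrow> real"
  pen_factor :: "'m \<Rightarrow> real"
  lam_bound :: "'m \<Rightarrow> real"
  rho_bound :: "'m \<Rightarrow> real"

definition state_space :: "('m, 'n::finite, 'y) msp \<Rightarrow> nat \<Rightarrow> (real^'n) set" where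
  "state_space P t = {x. \<forall>i. i \<notin> coords P t \<longrightarrow> x $ i = 0}"

definition state_dim :: "('m, 'n::finite, 'y) msp \<Rightarrow> nat \<Rightarrow> nat" where
  "state_dim P t = card (coords P t)"

text \<open>The space and the set \<open>\<X>\<^bsub>t-1\<^esub>\<close> of the states entering stage \<open>t\<close>, where \<open>\<X>\<^bsub>-1\<^esub> = {0}\<close>.\<close>

definition prev_space :: "('m, 'n::finite, 'y) msp \<Rightarrow> nat \<Rightarrow> (real^'n) set" where
  "prev_space P t = (case t of 0 \<Rightarrow> {0} | Suc s \<Rightarrow> state_space P s)"

definition prev_states :: "('m, 'n::finite, 'y) msp \<Rightarrow> nat \<Rightarrow> (real^'n) set" where
  "prev_states P t = (case t of 0 \<Rightarrow> {0} | Suc s \<Rightarrow> states P s)"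

definition cost_dom ::
    "('m, 'n::finite, 'y) msp \<Rightarrow> nat \<Rightarrow> 'm \<Rightarrow> ((real^'n) \<times> 'y \<times> (real^'n)) set" where
  "cost_dom P t m = {(z, y, x). z \<in> prev_states P t \<and> (x, y) \<in> feas P m}"

definition valid_problem :: "('m, 'n::finite, 'y::euclidean_space) msp \<Rightarrow> bool" where
  "valid_problem P \<longleftrightarrow>
     1 \<le> horizon P \<and>
     (\<forall>t\<le>horizon P. finite (nodes P t)) \<and>
     (\<forall>s\<le>horizon P. \<forall>t\<le>horizon P. s \<noteq> t \<longrightarrow> nodes P s \<inter> nodes P t = {}) \<and>
     nodes P 0 = {rootnode P} \<and>
     (\<forall>t<horizon P. (\<forall>m\<in>nodes P (Suc t). 0 < prob P t m) \<and>
        (\<Sum>m\<in>nodes P (Suc t). prob P t m) = 1) \<and>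
     (\<forall>t<horizon P. states P t \<subseteq> state_space P t \<and>
        (\<forall>m\<in>nodes P t. fst ` feas P m = states P t)) \<and>
     (\<forall>t\<le>horizon P. \<forall>m\<in>nodes P t.
        compact (feas P m) \<and>
        (\<forall>(z, y, x)\<in>cost_dom P t m. 0 \<le> cost P m z y x) \<and>
        lsc_on (cost_dom P t m) (\<lambda>(z, y, x). cost P m z y x)) \<and>
     is_norm (nrm P)"

definition valid_regularization :: "('m, 'n::finite, 'y::euclidean_space) msp \<Rightarrow> bool" where
  "valid_regularization P \<longleftrightarrow>
     (\<forall>t\<le>horizon P. \<forall>m\<in>nodes P t.
        0 < pen_factor P m \<and>
        penalty_on (prev_space P t) (nrm P) (pen P m) \<and>
        (\<forall>a\<in>prev_states P t. \<forall>b\<in>prev_states P t. \<forall>a'\<in>prev_states P t. \<forall>b'\<in>prev_states P t.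
           \<bar>pen P m (a - b) - pen P m (a' - b')\<bar> \<le> nrm P ((a - b) - (a' - b'))))"

definition convex_problem :: "('m, 'n::finite, 'y::euclidean_space) msp \<Rightarrow> bool" where
  "convex_problem P \<longleftrightarrow>
     (\<forall>t\<le>horizon P. \<forall>m\<in>nodes P t.
        convex (feas P m) \<and>
        econvex_on (cost_dom P t m) (\<lambda>(z, y, x). cost P m z y x) \<and>
        convex_on (prev_space P t) (pen P m))"

definition norm_penalties :: "('m, 'n::finite, 'y) msp \<Rightarrow> bool" where
  "norm_penalties P \<longleftrightarrow>
     (\<forall>t<horizon P. \<forall>m\<in>nodes P (Suc t). \<forall>x\<in>state_space P t. pen P m x = nrm P x)"

definition valid_dual_bounds :: "('m, 'n::finite, 'y::euclidean_space) msp \<Rightarrow> bool" where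
  "valid_dual_bounds P \<longleftrightarrow>
     (\<forall>t<horizon P. \<forall>m\<in>nodes P (Suc t).
        0 \<le> lam_bound P m \<and> 0 \<le> rho_bound P m \<and>
        (if convex_problem P \<and> norm_penalties P
         then pen_factor P m \<le> lam_bound P m \<and> rho_bound P m = 0
         else pen_factor P m \<le> rho_bound P m))"

text \<open>The set \<open>\<U>\<^sub>m\<close> for a node \<open>m\<close> of stage \<open>t + 1\<close>.\<close>

definition dual_set ::
    "('m, 'n::finite, 'y) msp \<Rightarrow> nat \<Rightarrow> 'm \<Rightarrow> ((real^'n) \<times> real) set" where
  "dual_set P t m = {(l, r). l \<in> state_space P t \<and>
     dual_norm (state_space P t) (nrm P) l \<le> lam_bound P m \<and> 0 \<le> r \<and> r \<le> rho_bound P m}"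

definition lip_const :: "('m, 'n::finite, 'y) msp \<Rightarrow> nat \<Rightarrow> real" where
  "lip_const P t = (\<Sum>m\<in>nodes P (Suc t). prob P t m * (lam_bound P m + rho_bound P m))"

definition state_diam :: "('m, 'n::finite, 'y) msp \<Rightarrow> nat \<Rightarrow> real" where
  "state_diam P t = enclosing_diameter (state_space P t) (nrm P) (states P t)"


section \<open>Scenario tree\<close>

definition tree :: "('m, 'n::finite, 'y) msp \<Rightarrow> 'm list set" where
  "tree P = {n. length n \<le> horizon P \<and> (\<forall>s<length n. n ! s \<in> nodes P (Suc s))}"

definition data_node :: "('m, 'n::finite, 'y) msp \<Rightarrow> 'm list \<Rightarrow> 'm" where
  "data_node P n = (if n = [] then rootnode P else last n)"

definition tree_prob :: "('m, 'n::finite, 'y) msp \<Rightarrow> 'm list \<Rightarrow> real" where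
  "tree_prob P n = (\<Prod>s<length n. prob P s (n ! s))"

definition parent_state :: "('m list \<Rightarrow> real^'n::finite) \<Rightarrow> 'm list \<Rightarrow> real^'n" where
  "parent_state x n = (if n = [] then 0 else x (butlast n))"

definition feasible_finite :: "('m, 'n::finite, 'y) msp \<Rightarrow> bool" where
  "feasible_finite P \<longleftrightarrow>
     (\<exists>x y. (\<forall>n\<in>tree P. (x n, y n) \<in> feas P (data_node P n)) \<and>
        (\<Sum>n\<in>tree P. ereal (tree_prob P n) *
           cost P (data_node P n) (parent_state x n) (y n) (x n)) < \<infinity>)"

definition reg_tree_feasible ::
    "('m, 'n::finite, 'y) msp \<Rightarrow>
     ('m list \<Rightarrow> real^'n) \<times> ('m list \<Rightarrow> 'y) \<times> ('m list \<Rightarrow> real^'n) \<Rightarrow> bool" where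
  "reg_tree_feasible P = (\<lambda>(x, y, z).
     \<forall>n\<in>tree P. (x n, y n) \<in> feas P (data_node P n) \<and> z n \<in> prev_states P (length n))"

definition reg_tree_cost ::
    "('m, 'n::finite, 'y) msp \<Rightarrow>
     ('m list \<Rightarrow> real^'n) \<times> ('m list \<Rightarrow> 'y) \<times> ('m list \<Rightarrow> real^'n) \<Rightarrow> ereal" where
  "reg_tree_cost P = (\<lambda>(x, y, z).
     \<Sum>n\<in>tree P. ereal (tree_prob P n) *
       (cost P (data_node P n) (z n) (y n) (x n) +
        ereal (pen_factor P (data_node P n) * pen P (data_node P n) (parent_state x n - z n))))"

definition exact_regularization :: "('m, 'n::finite, 'y) msp \<Rightarrow> bool" where
  "exact_regularization P \<longleftrightarrow>
     (\<forall>x y z. is_arg_min (reg_tree_cost P) (reg_tree_feasible P) (x, y, z) \<longrightarrow>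
        (\<forall>n\<in>tree P. z n = parent_state x n))"


section \<open>Regularized value functions\<close>

text \<open>Subproblem of a node \<open>m\<close> of stage \<open>t\<close> with incoming state \<open>xp\<close> and cost-to-go \<open>W\<close>.\<close>

definition sub_feasible ::
    "('m, 'n::finite, 'y) msp \<Rightarrow> nat \<Rightarrow> 'm \<Rightarrow> (real^'n) \<times> 'y \<times> (real^'n) \<Rightarrow> bool" where
  "sub_feasible P t m = (\<lambda>(x, y, z). (x, y) \<in> feas P m \<and> z \<in> prev_states P t)"

definition sub_cost ::
    "('m, 'n::finite, 'y) msp \<Rightarrow> 'm \<Rightarrow> (real^'n \<Rightarrow> ereal) \<Rightarrow> real^'n \<Rightarrow>
     (real^'n) \<times> 'y \<times> (real^'n) \<Rightarrow> ereal" where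
  "sub_cost P m W xp = (\<lambda>(x, y, z).
     cost P m z y x + ereal (pen_factor P m * pen P m (xp - z)) + W x)"

definition sub_value ::
    "('m, 'n::finite, 'y) msp \<Rightarrow> nat \<Rightarrow> 'm \<Rightarrow> (real^'n \<Rightarrow> ereal) \<Rightarrow> real^'n \<Rightarrow> ereal" where
  "sub_value P t m W xp = (INF w\<in>Collect (sub_feasible P t m). sub_cost P m W xp w)"

function QR :: "('m, 'n::finite, 'y) msp \<Rightarrow> nat \<Rightarrow> real^'n \<Rightarrow> ereal" where
  "QR P t = (if t < horizon P
     then (\<lambda>x. \<Sum>m\<in>nodes P (Suc t). ereal (prob P t m) * sub_value P (Suc t) m (QR P (Suc t)) x)
     else (\<lambda>x. 0))"
  by pat_completeness auto
termination
  by (relation "Wellfounded.measure (\<lambda>(P, t). horizon P - t)") auto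

declare QR.simps [simp del]

definition root_cost ::
    "('m, 'n::finite, 'y) msp \<Rightarrow> (real^'n \<Rightarrow> ereal) \<Rightarrow> (real^'n) \<times> 'y \<Rightarrow> ereal" where
  "root_cost P W = (\<lambda>(x, y). cost P (rootnode P) 0 y x + W x)"

definition v_reg :: "('m, 'n::finite, 'y) msp \<Rightarrow> ereal" where
  "v_reg P = (INF w\<in>feas P (rootnode P). root_cost P (QR P 0) w)"

definition eps_optimal_root ::
    "('m, 'n::finite, 'y) msp \<Rightarrow> real \<Rightarrow> (real^'n) \<times> 'y \<Rightarrow> bool" where
  "eps_optimal_root P eps w \<longleftrightarrow>
     w \<in> feas P (rootnode P) \<and> root_cost P (QR P 0) w \<le> v_reg P + ereal eps"


section \<open>Deterministic sampling algorithm\<close>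

text \<open>The quantities computed in a run of the algorithm; the first argument is always the iteration
  index. \<open>stage_x R i t\<close> is \<open>x\<^sub>t\<^sup>i\<close>, and \<open>lowQ\<close>, \<open>upQ\<close> are the under- and overestimators.
  \<open>LB R i\<close>, \<open>UB R i\<close>, \<open>best R i\<close> are the values of LB, UB and the incumbent
  \<open>(x\<^sub>0\<^sup>*, y\<^sub>0\<^sup>*)\<close> after iteration \<open>i\<close>; for \<open>i = 0\<close> they are the values before the first
  iteration, when there is no incumbent and \<open>best R 0\<close> is unconstrained.\<close>

record ('m, 'n, 'y) run =
  stage_x :: "nat \<Rightarrow> nat \<Rightarrow> real^('n::finite)"
  root_y :: "nat \<Rightarrow> 'y"
  node_x :: "nat \<Rightarrow> 'm \<Rightarrow> real^'n"
  node_y :: "nat \<Rightarrow> 'm \<Rightarrow> 'y"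
  node_z :: "nat \<Rightarrow> 'm \<Rightarrow> real^'n"
  sel :: "nat \<Rightarrow> nat \<Rightarrow> 'm"
  lam :: "nat \<Rightarrow> 'm \<Rightarrow> real^'n"
  rho :: "nat \<Rightarrow> 'm \<Rightarrow> real"
  low_val :: "nat \<Rightarrow> 'm \<Rightarrow> ereal"
  up_val :: "nat \<Rightarrow> 'm \<Rightarrow> ereal"
  lowQ :: "nat \<Rightarrow> nat \<Rightarrow> real^'n \<Rightarrow> ereal"
  upQ :: "nat \<Rightarrow> nat \<Rightarrow> real^'n \<Rightarrow> ereal"
  LB :: "nat \<Rightarrow> ereal"
  UB :: "nat \<Rightarrow> ereal"
  best :: "nat \<Rightarrow> (real^'n) \<times> 'y"

definition run_init ::
    "('m, 'n::finite, 'y::euclidean_space) msp \<Rightarrow> ('m, 'n, 'y) run \<Rightarrow> bool" where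
  "run_init P R \<longleftrightarrow>
     (\<forall>t\<le>horizon P. lowQ R 0 t = (\<lambda>x. 0)) \<and>
     (\<forall>t<horizon P. upQ R 0 t = (\<lambda>x. \<infinity>)) \<and> upQ R 0 (horizon P) = (\<lambda>x. 0) \<and>
     is_arg_min (\<lambda>(x, y). cost P (rootnode P) 0 y x) (\<lambda>w. w \<in> feas P (rootnode P))
       (stage_x R 1 0, root_y R 1) \<and>
     LB R 0 = cost P (rootnode P) 0 (root_y R 1) (stage_x R 1 0) \<and>
     UB R 0 = \<infinity>"

definition gap ::
    "('m, 'n::finite, 'y) run \<Rightarrow> nat \<Rightarrow> nat \<Rightarrow> 'm \<Rightarrow> ereal" where
  "gap R i t n = upQ R (i - 1) t (node_x R i n) - lowQ R (i - 1) t (node_x R i n)"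

definition forward_step ::
    "('m, 'n::finite, 'y::euclidean_space) msp \<Rightarrow> ('m, 'n, 'y) run \<Rightarrow> nat \<Rightarrow> bool" where
  "forward_step P R i \<longleftrightarrow>
     (\<forall>t\<in>{1..horizon P}.
        (\<forall>n\<in>nodes P t.
           is_arg_min (sub_cost P n (lowQ R (i - 1) t) (stage_x R i (t - 1))) (sub_feasible P t n)
             (node_x R i n, node_y R i n, node_z R i n)) \<and>
        (t < horizon P \<longrightarrow>
           sel R i t \<in> nodes P t \<and> (\<forall>n\<in>nodes P t. gap R i t n \<le> gap R i t (sel R i t)) \<and>
           stage_x R i t = node_x R i (sel R i t)))"

text \<open>Objective and value of the inner minimization in the dual problem of node \<open>n\<close> of stage \<open>t\<close>.\<close>

definition inner_cost ::
    "('m, 'n::finite, 'y) msp \<Rightarrow> 'm \<Rightarrow> (real^'n \<Rightarrow> ereal) \<Rightarrow> real^'n \<Rightarrow> (real^'n) \<times> real \<Rightarrow>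
     (real^'n) \<times> 'y \<times> (real^'n) \<Rightarrow> ereal" where
  "inner_cost P n W xp = (\<lambda>(l, r) (x, y, z).
     cost P n z y x + ereal (l \<bullet> (xp - z) + r * pen P n (xp - z)) + W x)"

definition inner_value ::
    "('m, 'n::finite, 'y) msp \<Rightarrow> nat \<Rightarrow> 'm \<Rightarrow> (real^'n \<Rightarrow> ereal) \<Rightarrow> real^'n \<Rightarrow>
     (real^'n) \<times> real \<Rightarrow> ereal" where
  "inner_value P t n W xp u = (INF w\<in>Collect (sub_feasible P t n). inner_cost P n W xp u w)"

text \<open>The cut \<open>C\<^sub>m\<^sup>i\<close> of a node \<open>m\<close> of stage \<open>t + 1\<close>, and \<open>h\<^sub>t\<^sup>i\<close>.\<close>

definition cut ::
    "('m, 'n::finite, 'y) msp \<Rightarrow> ('m, 'n, 'y) run \<Rightarrow> nat \<Rightarrow> nat \<Rightarrow> 'm \<Rightarrow> real^'n \<Rightarrow> ereal" where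
  "cut P R i t m x =
     ereal (- (lam R i m \<bullet> (stage_x R i t - x)) - rho R i m * pen P m (stage_x R i t - x))
     + low_val R i m"

definition over_cut ::
    "('m, 'n::finite, 'y) msp \<Rightarrow> ('m, 'n, 'y) run \<Rightarrow> nat \<Rightarrow> nat \<Rightarrow> real^'n \<Rightarrow> ereal" where
  "over_cut P R i t x =
     (\<Sum>m\<in>nodes P (Suc t). ereal (prob P t m) *
        (up_val R i m + ereal (pen_factor P m * nrm P (x - stage_x R i t))))"

definition approx_update ::
    "('m, 'n::finite, 'y::euclidean_space) msp \<Rightarrow> ('m, 'n, 'y) run \<Rightarrow> nat \<Rightarrow> nat \<Rightarrow> bool" where
  "approx_update P R i t \<longleftrightarrow>
     lowQ R i t = (\<lambda>x. max (lowQ R (i - 1) t x)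
        (\<Sum>m\<in>nodes P (Suc t). ereal (prob P t m) * cut P R i t m x)) \<and>
     upQ R i t =
       (if convex_problem P then conv_env (state_space P t) (upQ R (i - 1) t) (over_cut P R i t)
        else (\<lambda>x. min (upQ R (i - 1) t x) (over_cut P R i t x)))"

definition backward_step ::
    "('m, 'n::finite, 'y::euclidean_space) msp \<Rightarrow> ('m, 'n, 'y) run \<Rightarrow> nat \<Rightarrow> bool" where
  "backward_step P R i \<longleftrightarrow>
     lowQ R i (horizon P) = (\<lambda>x. 0) \<and> upQ R i (horizon P) = (\<lambda>x. 0) \<and>
     (\<forall>t\<in>{1..horizon P}.
        (t < horizon P \<longrightarrow> approx_update P R i t) \<and>
        (\<forall>n\<in>nodes P t.
           low_val R i n =
             (SUP u\<in>dual_set P (t - 1) n. inner_value P t n (lowQ R i t) (stage_x R i (t - 1)) u) \<and>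
           is_arg_max (inner_value P t n (lowQ R i t) (stage_x R i (t - 1)))
             (\<lambda>u. u \<in> dual_set P (t - 1) n) (lam R i n, rho R i n) \<and>
           up_val R i n =
             sub_cost P n (upQ R i t) (stage_x R i (t - 1))
               (node_x R i n, node_y R i n, node_z R i n)))"

definition root_step ::
    "('m, 'n::finite, 'y::euclidean_space) msp \<Rightarrow> ('m, 'n, 'y) run \<Rightarrow> nat \<Rightarrow> bool" where
  "root_step P R i \<longleftrightarrow>
     approx_update P R i 0 \<and>
     (let w = (stage_x R (Suc i) 0, root_y R (Suc i)) in
        is_arg_min (root_cost P (lowQ R i 0)) (\<lambda>w. w \<in> feas P (rootnode P)) w \<and>
        LB R i = root_cost P (lowQ R i 0) w \<and>
        (if root_cost P (upQ R i 0) w < UB R (i - 1)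
         then UB R i = root_cost P (upQ R i 0) w \<and> best R i = w
         else UB R i = UB R (i - 1) \<and> best R i = best R (i - 1)))"

text \<open>Exactly the iterations \<open>1, \<dots>, k\<close> are executed, each choice of an optimal solution
  or of a node of maximal gap being arbitrary, and the stopping test succeeds after iteration \<open>k\<close>.\<close>

definition terminates_at ::
    "('m, 'n::finite, 'y::euclidean_space) msp \<Rightarrow> real \<Rightarrow> ('m, 'n, 'y) run \<Rightarrow> nat \<Rightarrow> bool" where
  "terminates_at P eps R k \<longleftrightarrow>
     run_init P R \<and>
     (\<forall>i\<in>{1..k}. ereal eps < UB R (i - 1) - LB R (i - 1) \<and>
        forward_step P R i \<and> backward_step P R i \<and> root_step P R i) \<and>
     UB R k - LB R k \<le> ereal eps"

end

theory Submission
  imports Defs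
begin

text \<open>Let \<open>\<delta> = \<epsilon> / T\<close>, and call the gap at stage \<open>t\<close> in iteration \<open>i\<close> the difference of the over- and
  the underestimator at the visited state \<open>x\<^sub>t\<^sup>i\<close>. As long as the algorithm has not stopped, the gap
  exceeds \<open>T\<delta>\<close> at the root while it vanishes at stage \<open>T\<close>, so there is a stage \<open>t\<close> whose gap
  exceeds \<open>(T - t)\<delta>\<close> although all gaps at stage \<open>t + 1\<close> are at most \<open>(T - t - 1)\<delta>\<close>. The cuts
  added in this iteration then keep the gap at stage \<open>t\<close> below \<open>(T - t)\<delta>\<close> in the ball of radius
  \<open>\<delta> / (2L)\<close> around \<open>x\<^sub>t\<^sup>i\<close>. Hence the states visited in the iterations with the same \<open>t\<close> are
  \<open>\<delta> / (2L)\<close>-separated, and comparing volumes bounds their number by \<open>(1 + 2LD / \<delta>)\<^sup>d\<close>.\<close>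

section \<open>Norms on Euclidean spaces\<close>

lemma is_norm_convex_on:
  assumes "is_norm nu"
  shows "convex_on UNIV nu"
proof (rule convex_onI)
  fix t :: real and x y
  assume t: "0 < t" "t < 1"
  have "nu ((1 - t) *\<^sub>R x + t *\<^sub>R y) \<le> nu ((1 - t) *\<^sub>R x) + nu (t *\<^sub>R y)"
    using assms unfolding is_norm_def by blast
  also have "\<dots> = (1 - t) * nu x + t * nu y"
    using assms t unfolding is_norm_def by simp
  finally show "nu ((1 - t) *\<^sub>R x + t *\<^sub>R y) \<le> (1 - t) * nu x + t * nu y" .
qed simp

text \<open>A norm given by its axioms alone is convex, and a convex function on an open set of a
  finite-dimensional space is continuous.\<close>

lemma is_norm_continuous:
  fixes nu :: "'a::euclidean_space \<Rightarrow> real"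
  assumes "is_norm nu"
  shows "continuous_on S nu"
  using convex_on_continuous[OF open_UNIV is_norm_convex_on[OF assms]]
  by (rule continuous_on_subset) simp

lemma is_norm_zero: "is_norm nu \<Longrightarrow> nu 0 = 0"
  unfolding is_norm_def by blast

lemma is_norm_minus:
  assumes "is_norm nu"
  shows "nu (- x) = nu x"
proof -
  have "nu ((- 1) *\<^sub>R x) = \<bar>- 1\<bar> * nu x"
    using assms unfolding is_norm_def by blast
  then show ?thesis by simp
qed

lemma is_norm_minus_commute:
  assumes "is_norm nu"
  shows "nu (x - y) = nu (y - x)"
  using is_norm_minus[OF assms, of "x - y"] by simp

text \<open>By compactness \<open>nu\<close> attains a positive minimum on the Euclidean unit
  sphere; homogeneity carries the bound to all vectors.\<close>

lemma is_norm_dominates: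
  fixes nu :: "'a::euclidean_space \<Rightarrow> real"
  assumes nu: "is_norm nu"
  obtains c where "0 < c" "\<And>x. norm x \<le> c * nu x"
proof -
  have pos: "0 < nu x" if "x \<noteq> 0" for x
    using nu that unfolding is_norm_def by (metis order_le_less)
  have "sphere (0::'a) 1 \<noteq> {}" by simp
  then obtain u where u: "u \<in> sphere 0 1" "\<And>x. x \<in> sphere 0 1 \<Longrightarrow> nu u \<le> nu x"
    using continuous_attains_inf[OF compact_sphere _ is_norm_continuous[OF nu]] by metis
  have nu0: "0 < nu u" using u(1) by (intro pos) auto
  show thesis
  proof (rule that[of "1 / nu u"])
    fix x :: 'a
    show "norm x \<le> 1 / nu u * nu x"
    proof (cases "x = 0")
      case True
      then show ?thesis using nu unfolding is_norm_def by simp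
    next
      case False
      then have "nu u \<le> nu (x /\<^sub>R norm x)" by (intro u) simp
      also have "\<dots> = nu x / norm x"
        using nu unfolding is_norm_def by (simp add: divide_inverse mult.commute)
      finally show ?thesis using False nu0 by (simp add: field_simps)
    qed
  qed (use nu0 in simp)
qed

text \<open>Test the supremum with \<open>x\<close> scaled to unit length. The supremum is a real
  \<open>Sup\<close>, so boundedness must come first; it follows from Cauchy-Schwarz because
  \<open>nu\<close> dominates the Euclidean norm.\<close>

lemma inner_le_dual_norm:
  fixes nu :: "'a::euclidean_space \<Rightarrow> real"
  assumes nu: "is_norm nu" and V: "subspace V" and x: "x \<in> V"
  shows "l \<bullet> x \<le> dual_norm V nu l * nu x"
proof (cases "x = 0")
  case True
  then show ?thesis by (simp add: is_norm_zero[OF nu])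
next
  case False
  then have pos: "0 < nu x"
    using nu unfolding is_norm_def by (metis order_le_less)
  obtain c where c: "0 < c" "\<And>x. norm x \<le> c * nu x"
    using is_norm_dominates[OF nu] by blast
  have "l \<bullet> y \<le> norm l * c" if "nu y \<le> 1" for y
  proof -
    have "l \<bullet> y \<le> norm l * norm y" by (rule norm_cauchy_schwarz)
    also have "\<dots> \<le> norm l * (c * 1)"
      using c that by (intro mult_left_mono order_trans[OF c(2)]) auto
    finally show ?thesis by simp
  qed
  then have bdd: "bdd_above {l \<bullet> x | x. x \<in> V \<and> nu x \<le> 1}"
    by (auto intro!: bdd_aboveI)
  have "(1 / nu x) *\<^sub>R x \<in> V" using V x by (rule subspace_scale)
  moreover have "nu ((1 / nu x) *\<^sub>R x) \<le> 1"
    using nu pos unfolding is_norm_def by simp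
  ultimately have "l \<bullet> ((1 / nu x) *\<^sub>R x) \<le> dual_norm V nu l"
    unfolding dual_norm_def using bdd by (intro cSup_upper) blast+
  then show ?thesis using pos by (simp add: field_simps)
qed

lemma dual_norm_le:
  assumes nu: "is_norm nu" and V: "subspace V" and "0 \<le> s"
    and le: "\<And>x. x \<in> V \<Longrightarrow> l \<bullet> x \<le> s * nu x"
  shows "dual_norm V nu l \<le> s"
  unfolding dual_norm_def
proof (rule cSup_least)
  show "{l \<bullet> x | x. x \<in> V \<and> nu x \<le> 1} \<noteq> {}"
    using is_norm_zero[OF nu] subspace_0[OF V] by (auto intro!: exI[of _ 0])
next
  fix b assume "b \<in> {l \<bullet> x | x. x \<in> V \<and> nu x \<le> 1}"
  then obtain x where "b = l \<bullet> x" "x \<in> V" "nu x \<le> 1" by blast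
  then show "b \<le> s"
    using le[of x] mult_left_mono[OF \<open>nu x \<le> 1\<close> \<open>0 \<le> s\<close>] by simp
qed

text \<open>Lagrangian duality for a norm penalty: the affine function separating the epigraph \<open>A\<close>
  from the open cone below \<open>v - s * nu (x - \<cdot>)\<close> has slope at most \<open>s\<close>.\<close>

lemma norm_penalty_exact_dual:
  fixes A :: "('a::euclidean_space \<times> real) set"
  assumes nu: "is_norm nu" and A: "convex A" "A \<noteq> {}" and s: "0 \<le> s"
    and up: "\<And>z a b. (z, a) \<in> A \<Longrightarrow> a \<le> b \<Longrightarrow> (z, b) \<in> A"
    and low: "\<And>z a. (z, a) \<in> A \<Longrightarrow> v \<le> a + s * nu (x - z)"
  obtains l where "\<And>w. l \<bullet> w \<le> s * nu w" "\<And>z a. (z, a) \<in> A \<Longrightarrow> v \<le> a + l \<bullet> (x - z)"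
proof -
  have nu0: "nu 0 = 0" by (rule is_norm_zero[OF nu])
  define B where "B = {(z, a). a < v - s * nu (x - z)}"
  have "convex B"
    unfolding convex_def
  proof (intro ballI allI impI)
    fix p q and g h :: real
    assume pq: "p \<in> B" "q \<in> B" and gh: "0 \<le> g" "0 \<le> h" "g + h = 1"
    obtain z a z' a' where [simp]: "p = (z, a)" "q = (z', a')" by (metis surj_pair)
    have lt: "a < v - s * nu (x - z)" "a' < v - s * nu (x - z')" using pq by (auto simp: B_def)
    have "x - (g *\<^sub>R z + h *\<^sub>R z') = g *\<^sub>R (x - z) + h *\<^sub>R (x - z')"
      using gh(3) by (simp add: algebra_simps flip: scaleR_add_left)
    then have "nu (x - (g *\<^sub>R z + h *\<^sub>R z')) \<le> g * nu (x - z) + h * nu (x - z')"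
      using is_norm_convex_on[OF nu] gh unfolding convex_on_def by simp
    then have le: "s * nu (x - (g *\<^sub>R z + h *\<^sub>R z')) \<le> s * (g * nu (x - z) + h * nu (x - z'))"
      using s by (rule mult_left_mono)
    have "g * a + h * a' < g * (v - s * nu (x - z)) + h * (v - s * nu (x - z'))"
    proof (cases "g = 0")
      case True then show ?thesis using gh lt by simp
    next
      case False
      then show ?thesis using gh lt
        by (intro add_less_le_mono mult_strict_left_mono mult_left_mono) auto
    qed
    also have "\<dots> = (g + h) * v - s * (g * nu (x - z) + h * nu (x - z'))"
      by (simp add: algebra_simps)
    finally show "g *\<^sub>R p + h *\<^sub>R q \<in> B" using le gh(3) by (simp add: B_def)
  qed
  moreover have "(x, v - 1) \<in> B" by (simp add: B_def nu0)
  moreover have "B \<inter> A = {}" using low by (force simp: B_def)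
  ultimately obtain c b where c: "c \<noteq> 0" "\<And>p. p \<in> B \<Longrightarrow> c \<bullet> p \<le> b" "\<And>p. p \<in> A \<Longrightarrow> b \<le> c \<bullet> p"
    using separating_hyperplane_sets[of B A] A by blast
  obtain p q where cpq: "c = (p, q)" by (cases c)
  have cB: "p \<bullet> z + q * a \<le> b" if "a < v - s * nu (x - z)" for z a
    using c(2)[of "(z, a)"] that by (simp add: B_def cpq)
  have cA: "b \<le> p \<bullet> z + q * a" if "(z, a) \<in> A" for z a
    using c(3)[OF that] by (simp add: cpq)
  \<comment> \<open>\<open>A\<close> is closed upwards, so a negative vertical coefficient would
    drive the functional to minus infinity on \<open>A\<close>.\<close>
  have "0 \<le> q"
  proof (rule ccontr)
    assume q: "\<not> 0 \<le> q"
    obtain z a where "(z, a) \<in> A" using A by auto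
    define e where "e = max a ((b - p \<bullet> z) / q + 1)"
    have "b \<le> p \<bullet> z + q * e"
      using up[OF \<open>(z, a) \<in> A\<close>, of e] by (intro cA) (simp add: e_def)
    moreover have "q * e \<le> q * ((b - p \<bullet> z) / q + 1)"
      using q by (intro mult_left_mono_neg) (auto simp: e_def)
    moreover have "q * ((b - p \<bullet> z) / q + 1) = b - p \<bullet> z + q" using q by (simp add: distrib_left)
    ultimately show False using q by linarith
  qed
  \<comment> \<open>The separating hyperplane is not vertical: \<open>B\<close> has points over
    every \<open>z\<close>, so a nonzero \<open>p\<close> would be bounded above on the whole
    space.\<close>
  moreover have "q \<noteq> 0"
  proof
    assume q: "q = 0"
    then have pp: "0 < p \<bullet> p" using c(1) cpq by (auto simp: zero_prod_def)
    define z where "z = ((b + 1) / (p \<bullet> p)) *\<^sub>R p"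
    have "p \<bullet> z \<le> b" using cB[of "v - s * nu (x - z) - 1" z] q by simp
    then show False using pp by (simp add: z_def)
  qed
  ultimately have q: "0 < q" by simp
  define l where "l = - (1 / q) *\<^sub>R p"
  have pl: "p = - q *\<^sub>R l" using q by (simp add: l_def)
  \<comment> \<open>Letting \<open>e\<close> tend to 0 extends the bound on \<open>B\<close> to its
    boundary, the graph of the concave cone.\<close>
  have cone: "v - s * nu (x - z) \<le> b / q + l \<bullet> z" for z
  proof (rule field_le_epsilon)
    fix e :: real assume "0 < e"
    then show "v - s * nu (x - z) \<le> b / q + l \<bullet> z + e"
      using cB[of "v - s * nu (x - z) - e" z] q by (simp add: pl field_simps)
  qed
  show thesis
  proof (rule that)
    fix z a assume "(z, a) \<in> A"
    from cA[OF this] have "b / q + l \<bullet> z \<le> a" using q by (simp add: pl field_simps)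
    then show "v \<le> a + l \<bullet> (x - z)" using cone[of x] by (simp add: nu0 inner_diff_right)
  next
    fix w
    define K where "K = b / q + l \<bullet> x - v"
    \<comment> \<open>Along the ray \<open>x - t *\<^sub>R w\<close> the slack stays below the
      constant \<open>K\<close>, so its linear rate of growth cannot be positive.\<close>
    have K: "t * (l \<bullet> w - s * nu w) \<le> K" if "0 \<le> t" for t
    proof -
      have "nu (t *\<^sub>R w) = t * nu w" using nu that unfolding is_norm_def by simp
      then show ?thesis
        using cone[of "x - t *\<^sub>R w"] by (simp add: K_def inner_diff_right algebra_simps)
    qed
    show "l \<bullet> w \<le> s * nu w"
    proof (rule ccontr)
      assume "\<not> l \<bullet> w \<le> s * nu w"
      then show False using K[of "(K + 1) / (l \<bullet> w - s * nu w)"] K[of 0] by simp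
    qed
  qed
qed

section \<open>Packings\<close>

definition coord_subspace :: "'n::finite set \<Rightarrow> (real^'n) set" where
  "coord_subspace K = {x. \<forall>i. i \<notin> K \<longrightarrow> x $ i = 0}"

definition coord_proj :: "'n::finite set \<Rightarrow> real^'n \<Rightarrow> real^'n" where
  "coord_proj K x = (\<chi> i. if i \<in> K then x $ i else 0)"

lemma subspace_coord_subspace: "subspace (coord_subspace K)"
  by (auto simp: coord_subspace_def subspace_def)

lemma linear_coord_proj: "linear (coord_proj K)"
  by (rule linearI) (auto simp: coord_proj_def vec_eq_iff)

lemma coord_proj_in: "coord_proj K x \<in> coord_subspace K"
  by (simp add: coord_proj_def coord_subspace_def)

lemma coord_proj_eq: "x \<in> coord_subspace K \<Longrightarrow> coord_proj K x = x"
  by (auto simp: coord_proj_def coord_subspace_def vec_eq_iff)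

text \<open>Lets a multiplier be moved into the subspace without changing its action there.\<close>

lemma inner_coord_proj:
  "x \<in> coord_subspace K \<Longrightarrow> coord_proj K l \<bullet> x = l \<bullet> x"
  by (auto simp: coord_proj_def coord_subspace_def inner_vec_def intro!: sum.cong)

text \<open>The \<open>nu\<close>-ball of the coordinate subspace, thickened by the unit cube in the remaining
  directions, so that its Lebesgue measure scales like the dimension of the subspace.\<close>

definition slab :: "'n::finite set \<Rightarrow> (real^'n \<Rightarrow> real) \<Rightarrow> real \<Rightarrow> (real^'n) set" where
  "slab K nu r = {x. nu (coord_proj K x) < r \<and> (\<forall>i. i \<notin> K \<longrightarrow> 0 < x $ i \<and> x $ i < 1)}"

section \<open>Lebesgue measure of slabs\<close>

lemma open_slab:
  assumes nu: "is_norm nu"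
  shows "open (slab K nu r)"
proof -
  have "continuous_on UNIV (\<lambda>x. nu (coord_proj K x))"
    by (intro continuous_on_compose2[OF is_norm_continuous[OF nu, of UNIV]]
        linear_continuous_on linear_conv_bounded_linear[THEN iffD1] linear_coord_proj) auto
  then have "open {x. nu (coord_proj K x) < r}"
    by (intro open_Collect_less) auto
  moreover have "open (\<Inter>i\<in>-K. {x :: real^'a. 0 < x $ i \<and> x $ i < 1})"
    by (intro open_INT ballI open_Collect_conj open_Collect_less)
      (auto intro!: continuous_intros)
  moreover have "slab K nu r
      = {x. nu (coord_proj K x) < r} \<inter> (\<Inter>i\<in>-K. {x. 0 < x $ i \<and> x $ i < 1})"
    by (auto simp: slab_def)
  ultimately show ?thesis by auto
qed

lemma slab_lmeasurable:
  assumes nu: "is_norm nu"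
  shows "slab K nu r \<in> lmeasurable"
proof (rule lmeasurable_open)
  show "open (slab K nu r)" by (rule open_slab[OF nu])
  obtain c where c: "0 < c" "\<And>x. norm x \<le> c * nu x"
    using is_norm_dominates[OF nu] by blast
  \<comment> \<open>Coordinates in \<open>K\<close> are controlled through \<open>nu\<close>, the
    others by the unit cube.\<close>
  have "\<bar>x $ i\<bar> \<le> max 1 (c * r)" if x: "x \<in> slab K nu r" for x i
  proof (cases "i \<in> K")
    case True
    then have "\<bar>x $ i\<bar> = \<bar>coord_proj K x $ i\<bar>" by (simp add: coord_proj_def)
    also have "\<dots> \<le> norm (coord_proj K x)" by (rule component_le_norm_cart)
    also have "\<dots> \<le> c * r"
      using c(1) x by (intro order_trans[OF c(2)] mult_left_mono) (auto simp: slab_def)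
    finally show ?thesis by simp
  qed (use x in \<open>fastforce simp: slab_def max_def\<close>)
  then have "(\<Sum>i\<in>UNIV. \<bar>x $ i\<bar>) \<le> (\<Sum>i\<in>(UNIV::'a set). max 1 (c * r))" if "x \<in> slab K nu r" for x
    using that by (intro sum_mono)
  then have "norm x \<le> (\<Sum>i\<in>(UNIV::'a set). max 1 (c * r))" if "x \<in> slab K nu r" for x
    using that norm_le_l1_cart[of x] by (meson order_trans)
  then show "bounded (slab K nu r)"
    by (rule boundedI)
qed

lemma measure_slab_pos:
  assumes nu: "is_norm nu" and r: "0 < r"
  shows "0 < measure lebesgue (slab K nu r)"
proof -
  \<comment> \<open>The centre of the cube, with vanishing part in \<open>K\<close>, shows that the
    open set is nonempty and hence not negligible.\<close>
  have "(\<chi> i. if i \<in> K then 0 else 1 / 2) \<in> slab K nu r"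
  proof -
    have "coord_proj K (\<chi> i. if i \<in> K then 0 else 1 / 2) = 0"
      by (simp add: coord_proj_def vec_eq_iff)
    then show ?thesis using r by (simp add: slab_def is_norm_zero[OF nu])
  qed
  then have "\<not> negligible (slab K nu r)" using open_not_negligible[OF open_slab[OF nu]] by blast
  then show ?thesis
    using negligible_iff_measure slab_lmeasurable[OF nu] by (metis zero_less_measure_iff)
qed

text \<open>Stretching the coordinates in \<open>K\<close> by \<open>r\<close> and fixing the others
  maps the slab of radius 1 onto that of radius \<open>r\<close>; the determinant is
  \<open>r ^ card K\<close>.\<close>

lemma measure_slab:
  assumes nu: "is_norm nu" and r: "0 < r"
  shows "measure lebesgue (slab K nu r) = r ^ card K * measure lebesgue (slab K nu 1)"
proof -
  define m where "m k = (if k \<in> K then r else 1)" for k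
  have scale: "coord_proj K (\<chi> k. m k * x $ k) = r *\<^sub>R coord_proj K x" for x
    by (simp add: coord_proj_def m_def vec_eq_iff)
  have nus: "nu (r *\<^sub>R y) = r * nu y" for y
    using nu r unfolding is_norm_def by simp
  have in_slab: "(\<chi> k. m k * x $ k) \<in> slab K nu r \<longleftrightarrow> x \<in> slab K nu 1" for x
  proof -
    have "r * y < r \<longleftrightarrow> y < 1" for y using r by simp
    then show ?thesis by (simp add: slab_def scale nus) (simp add: m_def)
  qed
  have "slab K nu r = (\<lambda>x. \<chi> k. m k * x $ k) ` slab K nu 1"
  proof (intro subset_antisym subsetI)
    fix x assume x: "x \<in> slab K nu r"
    define y where "y = (\<chi> k. x $ k / m k)"
    have xy: "x = (\<chi> k. m k * y $ k)" using r by (simp add: y_def m_def vec_eq_iff)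
    then have "y \<in> slab K nu 1" using x in_slab[of y] by simp
    with xy show "x \<in> (\<lambda>x. \<chi> k. m k * x $ k) ` slab K nu 1" by (rule image_eqI)
  qed (use in_slab in auto)
  moreover have "prod m UNIV = r ^ card K"
    by (simp add: m_def prod.If_cases)
  ultimately show ?thesis
    using measure_stretch[OF slab_lmeasurable[OF nu], of m K 1] r by simp
qed

text \<open>Slabs of radius \<open>r\<close> around the points are disjoint and lie in the slab of
  radius \<open>s + r\<close> around \<open>c\<close>; comparing volumes bounds their number by the
  \<open>card K\<close>-th power of \<open>(s + r) / r\<close>.\<close>

lemma packing_bound:
  fixes p :: "'i \<Rightarrow> real^'n::finite"
  assumes nu: "is_norm nu" and I: "finite I" and r: "0 < r" and s: "0 \<le> s"
    and c: "c \<in> coord_subspace K"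
    and p: "\<And>i. i \<in> I \<Longrightarrow> p i \<in> coord_subspace K" "\<And>i. i \<in> I \<Longrightarrow> nu (p i - c) \<le> s"
    and sep: "\<And>i j. i \<in> I \<Longrightarrow> j \<in> I \<Longrightarrow> i \<noteq> j \<Longrightarrow> 2 * r \<le> nu (p i - p j)"
  shows "real (card I) \<le> (1 + s / r) ^ card K"
proof -
  define S where "S i = (+) (p i) ` slab K nu r" for i
  define Z where "Z = (+) c ` slab K nu (s + r)"
  have tri: "nu (x + y) \<le> nu x + nu y" for x y using nu unfolding is_norm_def by blast
  have off: "x $ i = 0" if "x \<in> coord_subspace K" "i \<notin> K" for x i
    using that by (simp add: coord_subspace_def)
  have proj: "coord_proj K (x - y) = coord_proj K x - coord_proj K y" for x y
    by (rule linear_diff[OF linear_coord_proj])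
  \<comment> \<open>The centres vanish off \<open>K\<close>, so translation leaves the cube
    conditions unchanged.\<close>
  have inS: "x \<in> S i \<longleftrightarrow> nu (coord_proj K x - p i) < r \<and> (\<forall>j. j \<notin> K \<longrightarrow> 0 < x $ j \<and> x $ j < 1)"
    if "i \<in> I" for x i
  proof -
    have "x \<in> S i \<longleftrightarrow> x - p i \<in> slab K nu r" by (force simp: S_def image_iff)
    then show ?thesis using p(1)[OF that] by (simp add: slab_def proj coord_proj_eq off)
  qed
  have inZ: "x \<in> Z \<longleftrightarrow> nu (coord_proj K x - c) < s + r \<and> (\<forall>j. j \<notin> K \<longrightarrow> 0 < x $ j \<and> x $ j < 1)"
    for x
  proof -
    have "x \<in> Z \<longleftrightarrow> x - c \<in> slab K nu (s + r)" by (force simp: Z_def image_iff)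
    then show ?thesis using c by (simp add: slab_def proj coord_proj_eq off)
  qed
  have "S i \<subseteq> Z" if "i \<in> I" for i
  proof
    fix x assume "x \<in> S i"
    then show "x \<in> Z"
      using tri[of "coord_proj K x - p i" "p i - c"] p(2)[OF that]
      by (simp add: inS[OF that] inZ)
  qed
  then have sub: "(\<Union>i\<in>I. S i) \<subseteq> Z" by blast
  have disj: "pairwise (\<lambda>i j. disjnt (S i) (S j)) I"
  proof (rule pairwiseI)
    fix i j assume ij: "i \<in> I" "j \<in> I" "i \<noteq> j"
    \<comment> \<open>A common point of two slabs would bring their centres closer than
      \<open>2 * r\<close>.\<close>
    have False if x: "x \<in> S i" "x \<in> S j" for x
    proof -
      have "nu (p i - p j) \<le> nu (p i - coord_proj K x) + nu (coord_proj K x - p j)"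
        using tri[of "p i - coord_proj K x" "coord_proj K x - p j"] by simp
      then show False
        using x sep[OF ij] is_norm_minus_commute[OF nu, of "p i" "coord_proj K x"]
        by (simp add: inS ij)
    qed
    then show "disjnt (S i) (S j)" by (auto simp: disjnt_def)
  qed
  define \<mu> where "\<mu> = measure lebesgue (slab K nu 1)"
  have \<mu>: "0 < \<mu>" unfolding \<mu>_def by (rule measure_slab_pos[OF nu]) simp
  have S: "S i \<in> lmeasurable" "measure lebesgue (S i) = r ^ card K * \<mu>" for i
    unfolding S_def \<mu>_def
    using measurable_translation[OF slab_lmeasurable[OF nu]] measure_slab[OF nu r]
    by (auto simp: measure_translation)
  have Z: "Z \<in> lmeasurable" "measure lebesgue Z = (s + r) ^ card K * \<mu>"
    unfolding Z_def \<mu>_def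
    using measurable_translation[OF slab_lmeasurable[OF nu]] measure_slab[OF nu, of "s + r"] r s
    by (auto simp: measure_translation)
  have "real (card I) * (r ^ card K * \<mu>) = (\<Sum>i\<in>I. measure lebesgue (S i))"
    by (simp add: S)
  also have "\<dots> = measure lebesgue (\<Union>i\<in>I. S i)"
    using I S disj by (intro measure_UNION'[symmetric]) auto
  also have "\<dots> \<le> (s + r) ^ card K * \<mu>"
    unfolding Z(2)[symmetric] using S I Z(1) sub
    by (intro measure_mono_fmeasurable sets.finite_UN) (auto simp: fmeasurableD)
  finally have "real (card I) * r ^ card K \<le> (s + r) ^ card K" using \<mu> by simp
  then have "real (card I) \<le> (s + r) ^ card K / r ^ card K"
    using r by (simp add: pos_le_divide_eq)
  also have "\<dots> = (1 + s / r) ^ card K"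
    using r by (simp add: add_divide_distrib add.commute flip: power_divide)
  finally show ?thesis .
qed

text \<open>A ball around 0 suffices, since \<open>nu\<close> is bounded on the compact closure of
  \<open>X\<close>. Nonemptiness makes the real \<open>Inf\<close> in
  \<open>enclosing_diameter\<close> meaningful.\<close>

lemma enclosing_radius_exists:
  assumes nu: "is_norm nu" and X: "bounded X" "X \<subseteq> coord_subspace K"
  shows "{2 * r | r. 0 \<le> r \<and>
    (\<exists>c\<in>coord_subspace K. X \<subseteq> {x \<in> coord_subspace K. nu (x - c) \<le> r})} \<noteq> {}" (is "?R \<noteq> {}")
proof -
  have "bounded (nu ` closure X)"
    using X(1) by (intro compact_imp_bounded compact_continuous_image is_norm_continuous nu) simp
  then have "bounded (nu ` X)" by (rule bounded_subset) (use closure_subset in blast)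
  then obtain b where b: "\<And>x. x \<in> X \<Longrightarrow> nu x \<le> b"
    unfolding bounded_real by (metis abs_le_D1 imageI)
  \<comment> \<open>For empty \<open>X\<close> the bound \<open>b\<close> may be negative, hence the
    maximum with 0.\<close>
  have "2 * max 0 b \<in> ?R"
    using subspace_0[OF subspace_coord_subspace, of K] X(2) b
    by (intro CollectI exI[of _ "max 0 b"] conjI bexI[of _ 0]) (auto simp: le_max_iff_disj)
  then show ?thesis by blast
qed

lemma enclosing_diameter_nonneg:
  assumes "is_norm nu" "bounded X" "X \<subseteq> coord_subspace K"
  shows "0 \<le> enclosing_diameter (coord_subspace K) nu X"
  unfolding enclosing_diameter_def
  using enclosing_radius_exists[OF assms] by (rule cInf_greatest) auto

text \<open>Instead of showing that the infimum of the radii is attained, the packing bound is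
  applied to a ball of diameter below \<open>D + e\<close>, and then \<open>e\<close> tends to
  0.\<close>

lemma enclosing_diameter_packing_bound:
  fixes p :: "'i \<Rightarrow> real^'n::finite"
  assumes nu: "is_norm nu" and I: "finite I" and r: "0 < r"
    and X: "bounded X" "X \<subseteq> coord_subspace K"
    and p: "\<And>i. i \<in> I \<Longrightarrow> p i \<in> X"
    and sep: "\<And>i j. i \<in> I \<Longrightarrow> j \<in> I \<Longrightarrow> i \<noteq> j \<Longrightarrow> 2 * r \<le> nu (p i - p j)"
    and D: "enclosing_diameter (coord_subspace K) nu X \<le> D"
  shows "real (card I) \<le> (1 + D / (2 * r)) ^ card K"
proof -
  have "real (card I) \<le> (1 + (D + e) / (2 * r)) ^ card K" if "0 < e" for e
  proof -
    have "Inf {2 * r | r. 0 \<le> r \<and> (\<exists>c\<in>coord_subspace K.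
        X \<subseteq> {x \<in> coord_subspace K. nu (x - c) \<le> r})} < D + e"
      using D that unfolding enclosing_diameter_def by linarith
    then obtain q c where q: "2 * q < D + e" "0 \<le> q" "c \<in> coord_subspace K"
        "X \<subseteq> {x \<in> coord_subspace K. nu (x - c) \<le> q}"
      using cInf_lessD[OF enclosing_radius_exists[OF nu X]] by blast
    have "real (card I) \<le> (1 + q / r) ^ card K"
      using q p X(2) by (intro packing_bound[OF nu I r q(2,3) _ _ sep]) auto
    also have "\<dots> \<le> (1 + (D + e) / (2 * r)) ^ card K"
      using q r by (intro power_mono add_left_mono) (auto simp: field_simps)
    finally show ?thesis .
  qed
  then have "\<forall>\<^sub>F e in at_right 0. real (card I) \<le> (1 + (D + e) / (2 * r)) ^ card K"
    by (auto simp: eventually_at_filter)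
  moreover have "((\<lambda>e. (1 + (D + e) / (2 * r)) ^ card K) \<longlongrightarrow> (1 + (D + 0) / (2 * r)) ^ card K)
      (at_right 0)"
    using r by (intro tendsto_intros) auto
  ultimately show ?thesis
    using tendsto_lowerbound trivial_limit_at_right_real by fastforce
qed

section \<open>Convex envelopes\<close>

text \<open>The Fenchel-Young inequality: a biconjugate lies below its function. Thus in the convex
  case, too, an update of the overestimator stays below both the old one and the new cut.\<close>

lemma conv_env_le:
  assumes "x \<in> V"
  shows "conv_env V g h x \<le> min (g x) (h x)"
  unfolding conv_env_def
proof (subst conjugate_def, rule SUP_least)
  fix s assume "s \<in> V"
  let ?f = "\<lambda>x. min (g x) (h x)"
  have "ereal (s \<bullet> x) - ?f x \<le> conjugate V ?f s"
    unfolding conjugate_def by (rule SUP_upper) fact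
  then show "ereal (x \<bullet> s) - conjugate V ?f s \<le> ?f x"
    by (cases "?f x"; cases "conjugate V ?f s") (auto simp: inner_commute)
qed

section \<open>Subproblems\<close>

lemma is_arg_min_le: "is_arg_min f S x \<Longrightarrow> S y \<Longrightarrow> f x \<le> f y" for f :: "'a \<Rightarrow> 'b::linorder"
  by (auto simp: is_arg_min_linorder)

lemma state_space_eq: "state_space P t = coord_subspace (coords P t)"
  by (simp add: state_space_def coord_subspace_def)

locale multistage_problem =
  fixes P :: "('m, 'n::finite, 'y::euclidean_space) msp"
  assumes valid: "valid_problem P"
    and feasible: "feasible_finite P"
    and regularization: "valid_regularization P"
    and dual_bounds: "valid_dual_bounds P"
begin

abbreviation "T \<equiv> horizon P"
abbreviation "\<sigma> \<equiv> pen_factor P"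
abbreviation "\<nu> \<equiv> nrm P"

text \<open>The branch of the dual bounds in which \<open>rho_bound\<close> vanishes, so that a
  linear multiplier alone has to replace the penalty.\<close>

definition norm_case :: bool where
  "norm_case \<longleftrightarrow> convex_problem P \<and> norm_penalties P"

section \<open>Elementary consequences of the problem data\<close>

lemma horizon_pos: "0 < T"
  using valid unfolding valid_problem_def by simp

lemma finite_nodes: "t \<le> T \<Longrightarrow> finite (nodes P t)"
  using valid unfolding valid_problem_def by simp

lemma nodes_0: "nodes P 0 = {rootnode P}"
  using valid unfolding valid_problem_def by simp

lemma prob_pos: "t < T \<Longrightarrow> m \<in> nodes P (Suc t) \<Longrightarrow> 0 < prob P t m"
  using valid unfolding valid_problem_def by simp

lemma prob_sum: "t < T \<Longrightarrow> (\<Sum>m\<in>nodes P (Suc t). prob P t m) = 1"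
  using valid unfolding valid_problem_def by simp

lemma states_subset: "t < T \<Longrightarrow> states P t \<subseteq> state_space P t"
  using valid unfolding valid_problem_def by simp

lemma fst_feas: "t < T \<Longrightarrow> m \<in> nodes P t \<Longrightarrow> fst ` feas P m = states P t"
  using valid unfolding valid_problem_def by simp

lemma feas_states: "t < T \<Longrightarrow> m \<in> nodes P t \<Longrightarrow> (x, y) \<in> feas P m \<Longrightarrow> x \<in> states P t"
  using fst_feas by force

lemma compact_feas: "t \<le> T \<Longrightarrow> m \<in> nodes P t \<Longrightarrow> compact (feas P m)"
  using valid unfolding valid_problem_def by blast

lemma cost_nonneg:
  "t \<le> T \<Longrightarrow> m \<in> nodes P t \<Longrightarrow> z \<in> prev_states P t \<Longrightarrow> (x, y) \<in> feas P m \<Longrightarrow> 0 \<le> cost P m z y x"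
  using valid unfolding valid_problem_def cost_dom_def by blast

lemma is_norm: "is_norm \<nu>"
  using valid unfolding valid_problem_def by simp

lemma nonneg_norm: "0 \<le> \<nu> x"
  using is_norm unfolding is_norm_def by simp

lemma nodes_nonempty: "t \<le> T \<Longrightarrow> nodes P t \<noteq> {}"
proof (cases t)
  case (Suc s)
  then show "t \<le> T \<Longrightarrow> nodes P t \<noteq> {}" using prob_sum[of s] by auto
qed (simp add: nodes_0)

lemma pen_factor_pos: "t \<le> T \<Longrightarrow> m \<in> nodes P t \<Longrightarrow> 0 < \<sigma> m"
  using regularization unfolding valid_regularization_def by blast

lemma subspace_state_space: "subspace (state_space P t)"
  by (simp add: state_space_eq subspace_coord_subspace)

lemma state_diff: "t < T \<Longrightarrow> a \<in> states P t \<Longrightarrow> b \<in> states P t \<Longrightarrow> a - b \<in> state_space P t"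
  using states_subset subspace_state_space by (blast intro: subspace_diff)

lemma pen_nonneg:
  assumes "t < T" "m \<in> nodes P (Suc t)" "a \<in> states P t" "b \<in> states P t"
  shows "0 \<le> pen P m (a - b)"
proof -
  have "penalty_on (prev_space P (Suc t)) \<nu> (pen P m)"
    using regularization assms Suc_leI unfolding valid_regularization_def by blast
  then show ?thesis
    using state_diff[OF assms(1,3,4)] by (simp add: penalty_on_def prev_space_def)
qed

text \<open>The Lipschitz condition concerns differences of states, so the comparison point 0 is
  written as \<open>b - b\<close>.\<close>

lemma pen_le_norm:
  assumes "t < T" "m \<in> nodes P (Suc t)" "a \<in> states P t" "b \<in> states P t"
  shows "pen P m (a - b) \<le> \<nu> (a - b)"
proof -
  have m: "Suc t \<le> T" using assms(1) by simp
  have "penalty_on (prev_space P (Suc t)) \<nu> (pen P m)"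
    using regularization m assms(2) unfolding valid_regularization_def by blast
  then have "pen P m 0 = 0"
    using subspace_0[OF subspace_state_space] by (simp add: penalty_on_def prev_space_def)
  moreover have "a \<in> prev_states P (Suc t)" "b \<in> prev_states P (Suc t)"
    using assms by (auto simp: prev_states_def)
  then have "\<bar>pen P m (a - b) - pen P m (b - b)\<bar> \<le> \<nu> ((a - b) - (b - b))"
    using regularization m assms(2) unfolding valid_regularization_def by blast
  ultimately show ?thesis by simp
qed

lemma dual_boundsD:
  assumes "t < T" "m \<in> nodes P (Suc t)"
  shows "0 \<le> lam_bound P m" "0 \<le> rho_bound P m"
    and "norm_case \<Longrightarrow> \<sigma> m \<le> lam_bound P m" "norm_case \<Longrightarrow> rho_bound P m = 0"
    and "\<not> norm_case \<Longrightarrow> \<sigma> m \<le> rho_bound P m"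
  using dual_bounds assms unfolding valid_dual_bounds_def norm_case_def by meson+

text \<open>The slope of the overestimating cuts is thereby bounded by the same constant as that of
  the underestimating ones.\<close>

lemma pen_factor_le:
  assumes "t < T" "m \<in> nodes P (Suc t)"
  shows "\<sigma> m \<le> lam_bound P m + rho_bound P m"
  using dual_boundsD[OF assms] by (cases norm_case) auto

lemma lip_const_pos:
  assumes t: "t < T"
  shows "0 < lip_const P t"
  unfolding lip_const_def
proof (rule sum_pos)
  fix m assume m: "m \<in> nodes P (Suc t)"
  have "0 < lam_bound P m + rho_bound P m"
    using pen_factor_le[OF t m] pen_factor_pos[OF _ m] t by simp
  then show "0 < prob P t m * (lam_bound P m + rho_bound P m)"
    using prob_pos[OF t m] by simp
qed (use t finite_nodes nodes_nonempty in auto)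

section \<open>Scenario tree and points of finite cost\<close>

lemma tree_data_node:
  assumes "n \<in> tree P"
  shows "data_node P n \<in> nodes P (length n)"
  using assms by (cases n rule: rev_cases) (force simp: tree_def data_node_def nodes_0)+

lemma butlast_tree: "n \<in> tree P \<Longrightarrow> butlast n \<in> tree P"
  by (auto simp: tree_def nth_butlast)

lemma finite_tree: "finite (tree P)"
proof (rule finite_subset)
  show "tree P \<subseteq> {n. set n \<subseteq> (\<Union>t\<le>T. nodes P t) \<and> length n \<le> T}"
    by (fastforce simp: tree_def in_set_conv_nth)
  show "finite {n. set n \<subseteq> (\<Union>t\<le>T. nodes P t) \<and> length n \<le> T}"
    by (intro finite_lists_length_le finite_UN_I finite_nodes) auto
qed

lemma tree_node_exists:
  assumes "t \<le> T" "m \<in> nodes P t"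
  obtains n where "n \<in> tree P" "length n = t" "data_node P n = m"
proof (cases t)
  case 0
  then show thesis
    using assms that[of "[]"] by (simp add: tree_def data_node_def nodes_0)
next
  case (Suc s)
  define e where "e j = (SOME m. m \<in> nodes P (Suc j))" for j
  have e: "e j \<in> nodes P (Suc j)" if "j < s" for j
  proof -
    have "nodes P (Suc j) \<noteq> {}" using nodes_nonempty[of "Suc j"] that Suc assms(1) by simp
    then show ?thesis by (simp add: e_def some_in_eq)
  qed
  show thesis
    using assms e Suc
    by (intro that[of "map e [0..<s] @ [m]"])
      (auto simp: tree_def data_node_def nth_append less_Suc_eq)
qed

text \<open>The finite objective of the tree problem is a sum with positive weights in which every
  node of every stage occurs, so none of its costs is infinite.\<close>

lemma finite_cost_point:
  assumes t: "t \<le> T" and m: "m \<in> nodes P t"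
  obtains x y z where "(x, y) \<in> feas P m" "z \<in> prev_states P t" "cost P m z y x < \<infinity>"
proof -
  obtain x y where feas: "\<And>n. n \<in> tree P \<Longrightarrow> (x n, y n) \<in> feas P (data_node P n)"
    and fin: "(\<Sum>n\<in>tree P. ereal (tree_prob P n) *
           cost P (data_node P n) (parent_state x n) (y n) (x n)) < \<infinity>"
    using feasible unfolding feasible_finite_def by blast
  have parent: "parent_state x n \<in> prev_states P (length n)" if "n \<in> tree P" for n
  proof (cases n rule: rev_cases)
    case Nil
    then show ?thesis by (simp add: parent_state_def prev_states_def)
  next
    case (snoc n' a)
    have "n' \<in> tree P" using butlast_tree[OF that] snoc by simp
    moreover have "length n' < T" using that snoc by (simp add: tree_def)
    ultimately show ?thesis
      using feas_states[OF _ tree_data_node feas] snoc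
      by (simp add: parent_state_def prev_states_def)
  qed
  have prob: "0 < tree_prob P n" if "n \<in> tree P" for n
    using that unfolding tree_prob_def by (intro prod_pos) (auto simp: tree_def intro!: prob_pos)
  obtain n where n: "n \<in> tree P" "length n = t" "data_node P n = m"
    using tree_node_exists[OF t m] .
  have "ereal (tree_prob P n) * cost P m (parent_state x n) (y n) (x n) \<noteq> \<infinity>"
    using fin finite_tree n sum_Pinfty by fastforce
  then have "cost P m (parent_state x n) (y n) (x n) \<noteq> \<infinity>"
    using prob[OF n(1)] by auto
  then show thesis
    using that feas[OF n(1)] parent[OF n(1)] n(2,3) by fastforce
qed

text \<open>In the case of convex data with norm penalties all cuts are affine, so that the
  underestimators are convex; only there is their convexity needed, for duality.\<close>

definition tractable :: "(real^'n \<Rightarrow> ereal) \<Rightarrow> bool" where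
  "tractable W \<longleftrightarrow>
     (\<exists>q. W = (\<lambda>x. ereal (q x)) \<and> (\<forall>x. 0 \<le> q x) \<and> (norm_case \<longrightarrow> convex_on UNIV q))"

lemma tractable_zero: "tractable (\<lambda>x. 0)"
  unfolding tractable_def
  by (rule exI[of _ "\<lambda>x. 0"]) (simp add: zero_ereal_def convex_on_const)

section \<open>Finiteness and duality of the node subproblems\<close>

lemma sub_value_finite:
  assumes t: "t < T" and m: "m \<in> nodes P (Suc t)" and W: "tractable W" and a: "a \<in> states P t"
  obtains v where "sub_value P (Suc t) m W a = ereal v" "0 \<le> v"
proof -
  obtain q where q: "W = (\<lambda>x. ereal (q x))" "\<And>x. 0 \<le> q x"
    using W unfolding tractable_def by blast
  have t': "Suc t \<le> T" using t by simp
  have low: "0 \<le> sub_value P (Suc t) m W a"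
    unfolding sub_value_def
  proof (rule INF_greatest)
    fix w assume "w \<in> Collect (sub_feasible P (Suc t) m)"
    then obtain x y z where w: "w = (x, y, z)" "(x, y) \<in> feas P m" "z \<in> states P t"
      by (cases w) (auto simp: sub_feasible_def prev_states_def)
    have "0 \<le> \<sigma> m * pen P m (a - z)"
      using pen_nonneg[OF t m a w(3)] pen_factor_pos[OF t' m] by simp
    moreover have "0 \<le> cost P m z y x"
      using cost_nonneg[OF t' m _ w(2)] w(3) by (simp add: prev_states_def)
    ultimately show "0 \<le> sub_cost P m W a w"
      using q by (simp add: sub_cost_def w(1))
  qed
  obtain x y z where w: "(x, y) \<in> feas P m" "z \<in> prev_states P (Suc t)" "cost P m z y x < \<infinity>"
    using finite_cost_point[OF t' m] .
  have "sub_value P (Suc t) m W a \<le> sub_cost P m W a (x, y, z)"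
    unfolding sub_value_def using w by (intro INF_lower) (simp add: sub_feasible_def)
  also have "\<dots> < \<infinity>"
    using w(3) q(1) by (simp add: sub_cost_def)
  finally show thesis
    using low that by (cases "sub_value P (Suc t) m W a") auto
qed

lemma inner_value_less_infinity:
  assumes t: "t < T" and m: "m \<in> nodes P (Suc t)" and W: "tractable W"
  shows "inner_value P (Suc t) m W a u < \<infinity>"
proof -
  obtain q where q: "W = (\<lambda>x. ereal (q x))"
    using W unfolding tractable_def by blast
  obtain x y z where w: "(x, y) \<in> feas P m" "z \<in> prev_states P (Suc t)" "cost P m z y x < \<infinity>"
    using finite_cost_point[OF Suc_leI[OF t] m] .
  have "inner_value P (Suc t) m W a u \<le> inner_cost P m W a u (x, y, z)"
    unfolding inner_value_def using w by (intro INF_lower) (simp add: sub_feasible_def)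
  also have "\<dots> < \<infinity>"
    using w(3) q by (simp add: inner_cost_def case_prod_unfold)
  finally show ?thesis .
qed

text \<open>A projection of a convex epigraph: the local variables \<open>x\<close> and
  \<open>y\<close> are eliminated, leaving the set in \<open>z\<close> and the value to which
  Lagrangian duality applies.\<close>

lemma convex_sub_epigraph:
  assumes t: "t < T" and m: "m \<in> nodes P (Suc t)" and "norm_case" and q: "convex_on UNIV q"
  shows "convex {(z, a). \<exists>x y. (z, y, x) \<in> cost_dom P (Suc t) m \<and>
    cost P m z y x + ereal (q x) \<le> ereal a}"
  unfolding convex_def
proof (intro ballI allI impI, clarsimp)
  fix z a z' a' x y x' y' and u v :: real
  assume uv: "0 \<le> u" "0 \<le> v" "u + v = 1"
    and d: "(z, y, x) \<in> cost_dom P (Suc t) m" "(z', y', x') \<in> cost_dom P (Suc t) m"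
    and le: "cost P m z y x + ereal (q x) \<le> ereal a" "cost P m z' y' x' + ereal (q x') \<le> ereal a'"
  have t': "Suc t \<le> T" using t by simp
  define F where "F = (\<lambda>(z, y, x). cost P m z y x)"
  have F: "econvex_on (cost_dom P (Suc t) m) F"
    using \<open>norm_case\<close> t' m unfolding norm_case_def convex_problem_def F_def by blast
  then have mem: "u *\<^sub>R (z, y, x) + v *\<^sub>R (z', y', x') \<in> cost_dom P (Suc t) m"
    using d uv unfolding econvex_on_def convex_def by blast
  have "F (u *\<^sub>R (z, y, x) + v *\<^sub>R (z', y', x'))
      \<le> ereal u * F (z, y, x) + ereal v * F (z', y', x')"
    using F d uv unfolding econvex_on_def by blast
  then have "cost P m (u *\<^sub>R z + v *\<^sub>R z') (u *\<^sub>R y + v *\<^sub>R y') (u *\<^sub>R x + v *\<^sub>R x')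
      \<le> ereal u * cost P m z y x + ereal v * cost P m z' y' x'"
    by (simp add: F_def)
  \<comment> \<open>Nonnegative and bounded above, the two costs are real numbers.\<close>
  moreover obtain c where c: "cost P m z y x = ereal c"
    using le(1) cost_nonneg[OF t' m, of z x y] d(1)
    by (cases "cost P m z y x") (auto simp: cost_dom_def)
  moreover obtain c' where c': "cost P m z' y' x' = ereal c'"
    using le(2) cost_nonneg[OF t' m, of z' x' y'] d(2)
    by (cases "cost P m z' y' x'") (auto simp: cost_dom_def)
  moreover have "q (u *\<^sub>R x + v *\<^sub>R x') \<le> u * q x + v * q x'"
    using q uv unfolding convex_on_def by simp
  moreover have "u * (c + q x) + v * (c' + q x') \<le> u * a + v * a'"
    using le c c' uv by (intro add_mono mult_left_mono) auto
  ultimately have "cost P m (u *\<^sub>R z + v *\<^sub>R z') (u *\<^sub>R y + v *\<^sub>R y') (u *\<^sub>R x + v *\<^sub>R x')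
      + ereal (q (u *\<^sub>R x + v *\<^sub>R x')) \<le> ereal (u * c + v * c') + ereal (u * q x + v * q x')"
    by (intro add_mono) auto
  also have "\<dots> \<le> ereal (u * a + v * a')"
    using \<open>u * (c + q x) + v * (c' + q x') \<le> u * a + v * a'\<close> by (simp add: algebra_simps)
  finally show "\<exists>x'' y''. (u *\<^sub>R z + v *\<^sub>R z', y'', x'') \<in> cost_dom P (Suc t) m \<and>
      cost P m (u *\<^sub>R z + v *\<^sub>R z') y'' x'' + ereal (q x'') \<le> ereal (u * a + v * a')"
    using mem by auto
qed

text \<open>Some admissible multiplier loses nothing against the regularized value. Outside
  \<open>norm_case\<close> the pair \<open>(0, \<sigma> m)\<close> reproduces the penalty itself; in
  \<open>norm_case\<close> duality gives a linear multiplier of dual norm at most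
  \<open>\<sigma> m\<close>.\<close>

lemma sub_value_le_inner_value:
  assumes t: "t < T" and m: "m \<in> nodes P (Suc t)" and W: "tractable W" and a: "a \<in> states P t"
  shows "\<exists>u\<in>dual_set P t m. sub_value P (Suc t) m W a \<le> inner_value P (Suc t) m W a u"
proof (cases norm_case)
  case False
  have "dual_norm (state_space P t) \<nu> 0 \<le> lam_bound P m"
    using dual_boundsD(1)[OF t m] nonneg_norm
    by (intro dual_norm_le[OF is_norm subspace_state_space]) auto
  then have "(0, \<sigma> m) \<in> dual_set P t m"
    using dual_boundsD(5)[OF t m False] pen_factor_pos[OF _ m] t
      subspace_0[OF subspace_state_space]
    by (simp add: dual_set_def less_imp_le)
  moreover have "inner_cost P m W a (0, \<sigma> m) = sub_cost P m W a"
    by (auto simp: inner_cost_def sub_cost_def)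
  ultimately show ?thesis
    unfolding sub_value_def inner_value_def by (intro bexI[of _ "(0, \<sigma> m)"]) simp_all
next
  case True
  have t': "Suc t \<le> T" using t by simp
  have \<sigma>: "0 \<le> \<sigma> m" using pen_factor_pos[OF t' m] by simp
  obtain q where q: "W = (\<lambda>x. ereal (q x))" "convex_on UNIV q"
    using W True unfolding tractable_def by blast
  obtain v where v: "sub_value P (Suc t) m W a = ereal v"
    using sub_value_finite[OF assms] by blast
  define A where "A = {(z, b). \<exists>x y. (z, y, x) \<in> cost_dom P (Suc t) m \<and>
    cost P m z y x + ereal (q x) \<le> ereal b}"
  have inA: "(z, c + q x) \<in> A"
    if "(x, y) \<in> feas P m" "z \<in> prev_states P (Suc t)" "cost P m z y x = ereal c" for x y z c
    using that by (force simp: A_def cost_dom_def)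
  obtain x0 y0 z0 where w0: "(x0, y0) \<in> feas P m" "z0 \<in> prev_states P (Suc t)"
      "cost P m z0 y0 x0 < \<infinity>"
    using finite_cost_point[OF t' m] .
  then obtain c0 where "cost P m z0 y0 x0 = ereal c0"
    using cost_nonneg[OF t' m w0(2,1)] by (cases "cost P m z0 y0 x0") auto
  then have "A \<noteq> {}" using inA[OF w0(1,2)] by blast
  moreover have "convex A"
    unfolding A_def by (rule convex_sub_epigraph[OF t m True q(2)])
  moreover have "(z, b') \<in> A" if "(z, b) \<in> A" "b \<le> b'" for z b b'
    using that unfolding A_def by clarsimp (meson ereal_less_eq(3) order_trans)
  moreover have "v \<le> b + \<sigma> m * \<nu> (a - z)" if zb: "(z, b) \<in> A" for z b
  proof -
    obtain x y where xy: "(x, y) \<in> feas P m" "z \<in> states P t"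
        "cost P m z y x + ereal (q x) \<le> ereal b"
      using zb by (auto simp: A_def cost_dom_def prev_states_def)
    have "ereal v \<le> sub_cost P m W a (x, y, z)"
      unfolding v[symmetric] sub_value_def using xy
      by (intro INF_lower) (simp add: sub_feasible_def prev_states_def)
    also have "\<dots> = (cost P m z y x + ereal (q x)) + ereal (\<sigma> m * pen P m (a - z))"
      by (simp add: sub_cost_def q(1) ac_simps)
    also have "\<dots> \<le> ereal b + ereal (\<sigma> m * \<nu> (a - z))"
      using xy(3) pen_le_norm[OF t m a xy(2)] \<sigma> by (intro add_mono) (auto intro: mult_left_mono)
    finally show ?thesis by simp
  qed
  ultimately obtain l where l: "\<And>w. l \<bullet> w \<le> \<sigma> m * \<nu> w"
      "\<And>z b. (z, b) \<in> A \<Longrightarrow> v \<le> b + l \<bullet> (a - z)"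
    using norm_penalty_exact_dual[OF is_norm _ _ \<sigma>, of A v a] by blast
  \<comment> \<open>Duality yields a functional on the whole space, but \<open>dual_set\<close>
    admits only vectors of \<open>state_space P t\<close>.\<close>
  define l' where "l' = coord_proj (coords P t) l"
  have l'_eq: "l' \<bullet> w = l \<bullet> w" if "w \<in> state_space P t" for w
    using that by (simp add: l'_def state_space_eq inner_coord_proj)
  have "dual_norm (state_space P t) \<nu> l' \<le> \<sigma> m"
    using l(1) l'_eq \<sigma> by (intro dual_norm_le[OF is_norm subspace_state_space]) auto
  then have "(l', 0) \<in> dual_set P t m"
    using dual_boundsD(2,3)[OF t m] True
    by (simp add: dual_set_def l'_def state_space_eq coord_proj_in)
  moreover have "ereal v \<le> inner_value P (Suc t) m W a (l', 0)"
    unfolding inner_value_def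
  proof (rule INF_greatest)
    fix w assume "w \<in> Collect (sub_feasible P (Suc t) m)"
    then obtain x y z where w: "w = (x, y, z)" "(x, y) \<in> feas P m" "z \<in> states P t"
      by (cases w) (auto simp: sub_feasible_def prev_states_def)
    have z: "z \<in> prev_states P (Suc t)" using w(3) by (simp add: prev_states_def)
    show "ereal v \<le> inner_cost P m W a (l', 0) w"
    proof (cases "cost P m z y x")
      case (real c)
      then show ?thesis
        using l(2)[OF inA[OF w(2) z real]] l'_eq[OF state_diff[OF t a w(3)]]
        by (simp add: inner_cost_def w(1) q(1))
    qed (use cost_nonneg[OF t' m z w(2)] in \<open>auto simp: inner_cost_def w(1)\<close>)
  qed
  ultimately show ?thesis using v by auto
qed

end

section \<open>Runs of the algorithm\<close>

locale algorithm_run = multistage_problem P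
  for P :: "('m, 'n::finite, 'y::euclidean_space) msp" +
  fixes R :: "('m, 'n, 'y) run" and eps :: real and k :: nat
  assumes terminates: "terminates_at P eps R k"
begin

lemma init: "run_init P R"
  using terminates unfolding terminates_at_def by blast

lemma iteration:
  assumes "1 \<le> i" "i \<le> k"
  shows "ereal eps < UB R (i - 1) - LB R (i - 1)"
    and "forward_step P R i" "backward_step P R i" "root_step P R i"
  using terminates assms unfolding terminates_at_def by simp_all

lemma approx_update_iteration:
  assumes "1 \<le> i" "i \<le> k" "t < T"
  shows "approx_update P R i t"
proof (cases t)
  case 0
  then show ?thesis using iteration(4)[OF assms(1,2)] unfolding root_step_def by blast
next
  case (Suc s)
  then show ?thesis
    using iteration(3)[OF assms(1,2)] assms(3) unfolding backward_step_def by auto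
qed

section \<open>Updates and monotonicity of the estimators\<close>

lemma lowQ_horizon: "i \<le> k \<Longrightarrow> lowQ R i T = (\<lambda>x. 0)"
  using init iteration(3)[of i] unfolding run_init_def backward_step_def
  by (cases i) auto

lemma upQ_horizon: "i \<le> k \<Longrightarrow> upQ R i T = (\<lambda>x. 0)"
  using init iteration(3)[of i] unfolding run_init_def backward_step_def
  by (cases i) auto

lemma lowQ_update:
  "1 \<le> i \<Longrightarrow> i \<le> k \<Longrightarrow> t < T \<Longrightarrow> lowQ R i t x = max (lowQ R (i - 1) t x)
     (\<Sum>m\<in>nodes P (Suc t). ereal (prob P t m) * cut P R i t m x)"
  using approx_update_iteration unfolding approx_update_def by simp

lemma upQ_update:
  assumes "1 \<le> i" "i \<le> k" "t < T" "x \<in> state_space P t"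
  shows "upQ R i t x \<le> upQ R (i - 1) t x" "upQ R i t x \<le> over_cut P R i t x"
  using approx_update_iteration[OF assms(1-3)]
    conv_env_le[OF assms(4), of "upQ R (i - 1) t" "over_cut P R i t"]
  unfolding approx_update_def by (auto split: if_splits)

lemma lowQ_mono:
  assumes "i \<le> j" "j \<le> k" "t < T"
  shows "lowQ R i t x \<le> lowQ R j t x"
  using assms
proof (induction j rule: dec_induct)
  case (step j)
  then show ?case using lowQ_update[of "Suc j" t x] by (simp add: le_max_iff_disj)
qed simp

lemma upQ_antimono:
  assumes "i \<le> j" "j \<le> k" "t < T" "x \<in> state_space P t"
  shows "upQ R j t x \<le> upQ R i t x"
  using assms
proof (induction j rule: dec_induct)
  case (step j)
  then show ?case using upQ_update(1)[of "Suc j" t x] by (auto intro: order_trans)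
qed simp

text \<open>The root state of iteration \<open>Suc j\<close> is computed at the end of iteration
  \<open>j\<close>, for \<open>j = 0\<close> in the initialization with the zero
  underestimator.\<close>

lemma root_solution:
  assumes "j \<le> k"
  shows "is_arg_min (root_cost P (lowQ R j 0)) (\<lambda>w. w \<in> feas P (rootnode P))
    (stage_x R (Suc j) 0, root_y R (Suc j))"
proof (cases j)
  case 0
  have "root_cost P (lowQ R 0 0) = (\<lambda>(x, y). cost P (rootnode P) 0 y x)"
    using init by (auto simp: run_init_def root_cost_def)
  then show ?thesis using 0 init by (simp add: run_init_def)
next
  case (Suc s)
  then show ?thesis using iteration(4)[of j] assms by (simp add: root_step_def Let_def)
qed

section \<open>Forward solutions and visited states\<close>

lemma node_solution:
  assumes "1 \<le> i" "i \<le> k" "t < T" "n \<in> nodes P (Suc t)"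
  shows "is_arg_min (sub_cost P n (lowQ R (i - 1) (Suc t)) (stage_x R i t)) (sub_feasible P (Suc t) n)
     (node_x R i n, node_y R i n, node_z R i n)"
  using iteration(2)[OF assms(1,2)] assms(3,4) unfolding forward_step_def
  by (auto dest!: bspec[of _ _ "Suc t"])

lemma node_feasible:
  assumes "1 \<le> i" "i \<le> k" "t < T" "n \<in> nodes P (Suc t)"
  shows "(node_x R i n, node_y R i n) \<in> feas P n" "node_z R i n \<in> prev_states P (Suc t)"
  using node_solution[OF assms] by (auto simp: is_arg_min_def sub_feasible_def)

lemma selected:
  assumes "1 \<le> i" "i \<le> k" "Suc t < T"
  shows "sel R i (Suc t) \<in> nodes P (Suc t)"
    and "n \<in> nodes P (Suc t) \<Longrightarrow> gap R i (Suc t) n \<le> gap R i (Suc t) (sel R i (Suc t))"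
    and "stage_x R i (Suc t) = node_x R i (sel R i (Suc t))"
  using iteration(2)[OF assms(1,2)] assms(3) unfolding forward_step_def
  by (auto dest!: bspec[of _ _ "Suc t"])

lemma stage_x_states:
  assumes "1 \<le> i" "i \<le> k" "t < T"
  shows "stage_x R i t \<in> states P t"
proof (cases t)
  case 0
  have "(stage_x R i 0, root_y R i) \<in> feas P (rootnode P)"
    using root_solution[of "i - 1"] assms by (simp add: is_arg_min_def)
  then show ?thesis using feas_states[of 0 "rootnode P"] 0 assms(3) by (simp add: nodes_0)
next
  case (Suc s)
  then show ?thesis
    using selected[of i s] node_feasible[of i s] feas_states[of t] assms by fastforce
qed

text \<open>Duality bounds the dual optimum from below. It is not infinite, being attained at the
  chosen multiplier, where the inner minimum is below infinity.\<close>

lemma low_val_bounds: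
  assumes i: "1 \<le> i" "i \<le> k" and t: "t < T" and n: "n \<in> nodes P (Suc t)"
    and W: "tractable (lowQ R i (Suc t))"
  shows "sub_value P (Suc t) n (lowQ R i (Suc t)) (stage_x R i t) \<le> low_val R i n"
    and "low_val R i n < \<infinity>" "(lam R i n, rho R i n) \<in> dual_set P t n"
proof -
  let ?v = "inner_value P (Suc t) n (lowQ R i (Suc t)) (stage_x R i t)"
  have eq: "low_val R i n = (SUP u\<in>dual_set P t n. ?v u)"
    and max: "is_arg_max ?v (\<lambda>u. u \<in> dual_set P t n) (lam R i n, rho R i n)"
    using iteration(3)[OF i] t n unfolding backward_step_def
    by (auto dest!: bspec[of _ _ "Suc t"])
  obtain u where "u \<in> dual_set P t n"
      "sub_value P (Suc t) n (lowQ R i (Suc t)) (stage_x R i t) \<le> ?v u"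
    using sub_value_le_inner_value[OF t n W stage_x_states[OF i t]] by blast
  then show "sub_value P (Suc t) n (lowQ R i (Suc t)) (stage_x R i t) \<le> low_val R i n"
    unfolding eq by (rule SUP_upper2)
  have "low_val R i n \<le> ?v (lam R i n, rho R i n)"
    unfolding eq using max by (intro SUP_least) (auto simp: is_arg_max_linorder)
  then show "low_val R i n < \<infinity>"
    using inner_value_less_infinity[OF t n W] by (rule le_less_trans)
  show "(lam R i n, rho R i n) \<in> dual_set P t n"
    using max by (simp add: is_arg_max_def)
qed

section \<open>Cuts as real functions\<close>

lemma low_val_real:
  assumes i: "1 \<le> i" "i \<le> k" and t: "t < T" and n: "n \<in> nodes P (Suc t)"
    and W: "tractable (lowQ R i (Suc t))"
  shows "low_val R i n = ereal (real_of_ereal (low_val R i n))"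
proof -
  obtain v where "sub_value P (Suc t) n (lowQ R i (Suc t)) (stage_x R i t) = ereal v"
    using sub_value_finite[OF t n W stage_x_states[OF i t]] by blast
  then show ?thesis
    using low_val_bounds(1,2)[OF assms] by (cases "low_val R i n") auto
qed

text \<open>A real-valued copy of \<open>cut\<close>, faithful where \<open>low_val\<close> is
  finite, so that sums and convexity can be treated in the reals.\<close>

definition real_cut :: "nat \<Rightarrow> nat \<Rightarrow> 'm \<Rightarrow> real^'n \<Rightarrow> real" where
  "real_cut i t m x = - (lam R i m \<bullet> (stage_x R i t - x))
     - rho R i m * pen P m (stage_x R i t - x) + real_of_ereal (low_val R i m)"

lemma sum_cut_eq:
  assumes "1 \<le> i" "i \<le> k" "t < T" "tractable (lowQ R i (Suc t))"
  shows "(\<Sum>m\<in>nodes P (Suc t). ereal (prob P t m) * cut P R i t m x)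
    = ereal (\<Sum>m\<in>nodes P (Suc t). prob P t m * real_cut i t m x)"
proof -
  have "cut P R i t m x = ereal (real_cut i t m x)" if "m \<in> nodes P (Suc t)" for m
    unfolding cut_def real_cut_def
    by (subst low_val_real[OF assms(1-3) that assms(4)]) simp
  then show ?thesis by simp
qed

lemma convex_on_sum_real_cut:
  assumes i: "1 \<le> i" "i \<le> k" and t: "t < T" and W: "tractable (lowQ R i (Suc t))"
    and "norm_case"
  shows "convex_on UNIV (\<lambda>x. \<Sum>m\<in>nodes P (Suc t). prob P t m * real_cut i t m x)"
proof -
  have cut: "real_cut i t m (u *\<^sub>R x + v *\<^sub>R y) = u * real_cut i t m x + v * real_cut i t m y"
    if m: "m \<in> nodes P (Suc t)" and uv: "u + v = 1" for m x y u v
  proof -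
    have "rho R i m = 0"
      using low_val_bounds(3)[OF i t m W] dual_boundsD(4)[OF t m \<open>norm_case\<close>]
      by (simp add: dual_set_def)
    moreover have v: "v = 1 - u" using uv by simp
    ultimately show ?thesis
      unfolding v by (simp add: real_cut_def inner_diff_right inner_add_right algebra_simps)
  qed
  show ?thesis
    unfolding convex_on_def
    by (auto simp: cut sum_distrib_left algebra_simps simp flip: sum.distrib)
qed

text \<open>The update at stage \<open>t\<close> uses the previous iteration at \<open>t\<close> and
  cuts computed from the current one at \<open>Suc t\<close>: hence induction forward over
  iterations and, inside, backward over stages.\<close>

lemma tractable_lowQ:
  assumes "i \<le> k" "t \<le> T"
  shows "tractable (lowQ R i t)"
  using assms
proof (induction i arbitrary: t)
  case 0
  then have "lowQ R 0 t = (\<lambda>x. 0)" using init by (simp add: run_init_def)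
  then show ?case using tractable_zero by simp
next
  case (Suc i)
  show ?case using Suc.prems(2)
  proof (induction t rule: inc_induct)
    case base
    then show ?case using lowQ_horizon[OF Suc.prems(1)] tractable_zero by simp
  next
    case (step t)
    have i: "1 \<le> Suc i" "Suc i \<le> k" using Suc.prems by auto
    obtain q where q: "lowQ R i t = (\<lambda>x. ereal (q x))" "\<And>x. 0 \<le> q x"
        "norm_case \<Longrightarrow> convex_on UNIV q"
      using Suc.IH[of t] i step.hyps unfolding tractable_def by auto
    define c where "c x = (\<Sum>m\<in>nodes P (Suc t). prob P t m * real_cut (Suc i) t m x)" for x
    have "lowQ R (Suc i) t = (\<lambda>x. ereal (max (q x) (c x)))"
      using lowQ_update[OF i step.hyps(2)] sum_cut_eq[OF i step.hyps(2) step.IH]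
      by (auto simp: q(1) c_def)
    moreover have "convex_on UNIV (\<lambda>x. max (q x) (c x))" if "norm_case"
      unfolding convex_on_def
    proof (intro conjI ballI allI impI)
      fix x y and u v :: real assume uv: "0 \<le> u" "0 \<le> v" "u + v = 1"
      have "q (u *\<^sub>R x + v *\<^sub>R y) \<le> u * q x + v * q y"
        using q(3)[OF that] uv unfolding convex_on_def by blast
      moreover have "c (u *\<^sub>R x + v *\<^sub>R y) \<le> u * c x + v * c y"
        using convex_on_sum_real_cut[OF i step.hyps(2) step.IH that] uv
        unfolding convex_on_def c_def by blast
      moreover have "u * q x \<le> u * max (q x) (c x)" "u * c x \<le> u * max (q x) (c x)"
          "v * q y \<le> v * max (q y) (c y)" "v * c y \<le> v * max (q y) (c y)"
        using uv by (auto intro: mult_left_mono)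
      ultimately show "max (q (u *\<^sub>R x + v *\<^sub>R y)) (c (u *\<^sub>R x + v *\<^sub>R y))
          \<le> u * max (q x) (c x) + v * max (q y) (c y)" by linarith
    qed simp
    ultimately show ?case
      unfolding tractable_def using q(2)
      by (intro exI[of _ "\<lambda>x. max (q x) (c x)"]) (simp add: le_max_iff_disj)
  qed
qed

lemma lowQ_real:
  assumes "i \<le> k" "t \<le> T"
  obtains r where "lowQ R i t x = ereal r" "0 \<le> r"
  using tractable_lowQ[OF assms] unfolding tractable_def by auto

text \<open>The cut takes the value \<open>low_val\<close> at the visited state and, by the bounds
  on the multipliers, falls off with at most the given slope.\<close>

lemma real_cut_lower:
  assumes i: "1 \<le> i" "i \<le> k" and t: "t < T" and n: "n \<in> nodes P (Suc t)" and x: "x \<in> states P t"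
  shows "real_of_ereal (low_val R i n) - (lam_bound P n + rho_bound P n) * \<nu> (x - stage_x R i t)
    \<le> real_cut i t n x"
proof -
  let ?s = "stage_x R i t"
  have s: "?s \<in> states P t" by (rule stage_x_states[OF i t])
  have sx: "\<nu> (?s - x) = \<nu> (x - ?s)" by (rule is_norm_minus_commute[OF is_norm])
  have dual: "dual_norm (state_space P t) \<nu> (lam R i n) \<le> lam_bound P n"
      "0 \<le> rho R i n" "rho R i n \<le> rho_bound P n"
    using low_val_bounds(3)[OF i t n tractable_lowQ] i t by (auto simp: dual_set_def)
  have "lam R i n \<bullet> (?s - x) \<le> dual_norm (state_space P t) \<nu> (lam R i n) * \<nu> (?s - x)"
    by (rule inner_le_dual_norm[OF is_norm subspace_state_space state_diff[OF t s x]])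
  also have "\<dots> \<le> lam_bound P n * \<nu> (?s - x)"
    using dual(1) nonneg_norm by (rule mult_right_mono)
  finally have "lam R i n \<bullet> (?s - x) \<le> lam_bound P n * \<nu> (?s - x)" .
  moreover have "rho R i n * pen P n (?s - x) \<le> rho_bound P n * \<nu> (?s - x)"
    using dual pen_nonneg[OF t n s x] pen_le_norm[OF t n s x] by (intro mult_mono) auto
  ultimately show ?thesis by (simp add: real_cut_def sx algebra_simps)
qed

text \<open>The forward solution is optimal for the old underestimator; exchanging that for the
  overestimator costs at most the gap \<open>g\<close> at the solution. As underestimators only
  grow, the old optimal value is at most \<open>low_val\<close>.\<close>

lemma up_val_le:
  assumes i: "1 \<le> i" "i \<le> k" and t: "t < T" and n: "n \<in> nodes P (Suc t)"
    and gap: "gap R i (Suc t) n \<le> ereal g"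
  shows "up_val R i n \<le> low_val R i n + ereal g"
proof -
  let ?w = "(node_x R i n, node_y R i n, node_z R i n)"
  let ?a = "stage_x R i t"
  have i': "i - 1 \<le> k" using i by simp
  have t': "Suc t \<le> T" using t by simp
  have a: "?a \<in> states P t" by (rule stage_x_states[OF i t])
  have feas: "(node_x R i n, node_y R i n) \<in> feas P n" "node_z R i n \<in> prev_states P (Suc t)"
    using node_feasible[OF i t n] .
  note tract = tractable_lowQ[OF i' t'] tractable_lowQ[OF i(2) t']
  have "sub_cost P n (lowQ R (i - 1) (Suc t)) ?a ?w
      \<le> sub_value P (Suc t) n (lowQ R (i - 1) (Suc t)) ?a"
    unfolding sub_value_def using is_arg_min_le[OF node_solution[OF i t n]]
    by (intro INF_greatest) simp
  moreover obtain v where "sub_value P (Suc t) n (lowQ R (i - 1) (Suc t)) ?a = ereal v"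
    using sub_value_finite[OF t n tract(1) a] by blast
  ultimately have v: "sub_cost P n (lowQ R (i - 1) (Suc t)) ?a ?w \<le> ereal v"
      "sub_value P (Suc t) n (lowQ R (i - 1) (Suc t)) ?a = ereal v" by auto
  \<comment> \<open>At stage \<open>T\<close> the estimators are identically 0, which
    \<open>lowQ_mono\<close> does not cover.\<close>
  have low: "lowQ R (i - 1) (Suc t) x \<le> lowQ R i (Suc t) x" for x
    using lowQ_mono[of "i - 1" i "Suc t" x] i t' lowQ_horizon[OF i'] lowQ_horizon[OF i(2)]
    by (cases "Suc t = T") auto
  have "sub_value P (Suc t) n (lowQ R (i - 1) (Suc t)) ?a
      \<le> sub_value P (Suc t) n (lowQ R i (Suc t)) ?a"
    unfolding sub_value_def
    by (intro INF_superset_mono) (auto simp: sub_cost_def simp del: One_nat_def intro!: add_left_mono low)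
  also have "\<dots> \<le> low_val R i n"
    by (rule low_val_bounds(1)[OF i t n tract(2)])
  finally have vl: "ereal v \<le> low_val R i n" using v by simp
  have "upQ R i (Suc t) (node_x R i n) \<le> upQ R (i - 1) (Suc t) (node_x R i n)"
  proof (cases "Suc t = T")
    case True
    then show ?thesis using upQ_horizon[OF i'] upQ_horizon[OF i(2)] by simp
  next
    case False
    then have T: "Suc t < T" using t by simp
    show ?thesis
      using feas_states[OF T n feas(1)] states_subset[OF T]
      by (intro upQ_update(1)[OF i T]) blast
  qed
  moreover obtain r where r: "lowQ R (i - 1) (Suc t) (node_x R i n) = ereal r"
    using lowQ_real[OF i' t'] by blast
  moreover have "upQ R (i - 1) (Suc t) (node_x R i n) - ereal r \<le> ereal g"
    using gap r by (simp add: gap_def)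
  then have "upQ R (i - 1) (Suc t) (node_x R i n) \<le> ereal (r + g)"
    by (cases "upQ R (i - 1) (Suc t) (node_x R i n)") auto
  ultimately have up: "upQ R i (Suc t) (node_x R i n) \<le> ereal (r + g)" by auto
  \<comment> \<open>With the cost known to be real, it can be kept fixed while the cost-to-go is
    exchanged.\<close>
  obtain c where c: "cost P n (node_z R i n) (node_y R i n) (node_x R i n) = ereal c"
    using v(1) r cost_nonneg[OF t' n feas(2,1)]
    by (cases "cost P n (node_z R i n) (node_y R i n) (node_x R i n)") (auto simp: sub_cost_def)
  have "up_val R i n = sub_cost P n (upQ R i (Suc t)) ?a ?w"
    using iteration(3)[OF i] t n unfolding backward_step_def
    by (auto dest!: bspec[of _ _ "Suc t"])
  also have "\<dots> \<le> ereal (c + \<sigma> n * pen P n (?a - node_z R i n)) + ereal (r + g)"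
    using up by (simp add: sub_cost_def c add_left_mono flip: plus_ereal.simps(1))
  also have "\<dots> \<le> ereal v + ereal g"
    using v(1) by (simp add: sub_cost_def c r del: One_nat_def)
  also have "\<dots> \<le> low_val R i n + ereal g" using vl by (rule add_right_mono)
  finally show ?thesis .
qed

text \<open>At the visited state the averaged upper and lower values differ by at most
  \<open>g\<close>. Away from it the upper cut rises and the lower cut falls with slope at most
  \<open>lip_const P t\<close>, which explains the factor 2.\<close>

lemma saturation:
  assumes i: "1 \<le> i" "i \<le> k" and t: "t < T" and x: "x \<in> states P t"
    and gap: "\<And>n. n \<in> nodes P (Suc t) \<Longrightarrow> gap R i (Suc t) n \<le> ereal g"
  shows "upQ R i t x \<le> lowQ R i t x + ereal (g + 2 * lip_const P t * \<nu> (x - stage_x R i t))"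
proof -
  let ?N = "nodes P (Suc t)" and ?p = "prob P t" and ?e = "\<nu> (x - stage_x R i t)"
  let ?l = "\<lambda>m. real_of_ereal (low_val R i m)"
  let ?b = "\<lambda>m. lam_bound P m + rho_bound P m"
  have tract: "tractable (lowQ R i (Suc t))" using i t by (intro tractable_lowQ) auto
  have "upQ R i t x \<le> over_cut P R i t x"
    using x states_subset[OF t] by (intro upQ_update(2)[OF i t]) blast
  also have "\<dots> \<le> (\<Sum>m\<in>?N. ereal (?p m) * ereal (?l m + g + ?b m * ?e))"
    unfolding over_cut_def
  proof (intro sum_mono ereal_mult_left_mono)
    fix m assume m: "m \<in> ?N"
    have "up_val R i m \<le> ereal (?l m + g)"
      using up_val_le[OF i t m gap[OF m]] low_val_real[OF i t m tract]
      by (metis plus_ereal.simps(1))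
    moreover have "\<sigma> m * ?e \<le> ?b m * ?e"
      using pen_factor_le[OF t m] nonneg_norm by (rule mult_right_mono)
    ultimately have "up_val R i m + ereal (\<sigma> m * ?e) \<le> ereal (?l m + g) + ereal (?b m * ?e)"
      by (intro add_mono) auto
    then show "up_val R i m + ereal (\<sigma> m * ?e) \<le> ereal (?l m + g + ?b m * ?e)" by simp
    show "0 \<le> ereal (?p m)" using prob_pos[OF t m] by simp
  qed
  also have "\<dots> = ereal (\<Sum>m\<in>?N. ?p m * (?l m + g + ?b m * ?e))" by simp
  also have "\<dots> \<le> ereal ((\<Sum>m\<in>?N. ?p m * real_cut i t m x) + (g + 2 * lip_const P t * ?e))"
  proof -
    have "(\<Sum>m\<in>?N. ?p m * (?l m + g + ?b m * ?e))
        \<le> (\<Sum>m\<in>?N. ?p m * (real_cut i t m x + g + 2 * ?b m * ?e))"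
    proof (intro sum_mono mult_left_mono)
      fix m assume m: "m \<in> ?N"
      show "?l m + g + ?b m * ?e \<le> real_cut i t m x + g + 2 * ?b m * ?e"
        using real_cut_lower[OF i t m x] by linarith
      show "0 \<le> ?p m" using prob_pos[OF t m] by simp
    qed
    also have "\<dots> = (\<Sum>m\<in>?N. ?p m * real_cut i t m x) + g * (\<Sum>m\<in>?N. ?p m)
        + 2 * ?e * lip_const P t"
      by (simp add: lip_const_def sum_distrib_left sum.distrib algebra_simps)
    finally show ?thesis using prob_sum[OF t] by (simp add: algebra_simps)
  qed
  also have "\<dots> = (\<Sum>m\<in>?N. ereal (?p m) * cut P R i t m x)
      + ereal (g + 2 * lip_const P t * ?e)"
    by (simp add: sum_cut_eq[OF i t tract])
  also have "\<dots> \<le> lowQ R i t x + ereal (g + 2 * lip_const P t * ?e)"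
    using lowQ_update[OF i t, of x] by (intro add_right_mono) simp
  finally show ?thesis .
qed

section \<open>Stage gaps and the count of iterations\<close>

definition stage_gap :: "nat \<Rightarrow> nat \<Rightarrow> ereal" where
  "stage_gap i t = upQ R (i - 1) t (stage_x R i t) - lowQ R (i - 1) t (stage_x R i t)"

text \<open>The stopping test failed before iteration \<open>i\<close>. Its bounds are the root cost
  plus over- and underestimator at the new root state, so the cost cancels once it is finite; in
  iteration 1 the overestimator is infinite.\<close>

lemma root_gap:
  assumes i: "1 \<le> i" "i \<le> k"
  shows "ereal eps < stage_gap i 0"
proof (cases "i = 1")
  case True
  have "upQ R 0 0 = (\<lambda>x. \<infinity>)" "lowQ R 0 0 = (\<lambda>x. 0)"
    using init horizon_pos by (auto simp: run_init_def)
  then show ?thesis by (simp add: stage_gap_def True)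
next
  case False
  define j where "j = i - 1"
  have j: "1 \<le> j" "j \<le> k" "i = Suc j" using i False by (auto simp: j_def)
  let ?x = "stage_x R (Suc j) 0" and ?y = "root_y R (Suc j)"
  let ?c = "cost P (rootnode P) 0 ?y ?x"
  have sol: "is_arg_min (root_cost P (lowQ R j 0)) (\<lambda>w. w \<in> feas P (rootnode P)) (?x, ?y)"
    by (rule root_solution[OF j(2)])
  have UB: "UB R j \<le> ?c + upQ R j 0 ?x" and LB: "LB R j = ?c + lowQ R j 0 ?x"
    using iteration(4)[OF j(1,2)]
    by (auto simp: root_step_def Let_def root_cost_def split: if_splits)
  obtain r where r: "lowQ R j 0 ?x = ereal r" using lowQ_real[OF j(2), of 0] by blast
  obtain x y z where pt: "(x, y) \<in> feas P (rootnode P)" "z \<in> prev_states P 0"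
      "cost P (rootnode P) z y x < \<infinity>"
    using finite_cost_point[of 0 "rootnode P"] nodes_0 by auto
  obtain r' where r': "lowQ R j 0 x = ereal r'" using lowQ_real[OF j(2), of 0] by blast
  have "?c + ereal r \<le> cost P (rootnode P) 0 y x + ereal r'"
    using is_arg_min_le[OF sol pt(1)] r r' by (simp add: root_cost_def)
  also have "\<dots> < \<infinity>" using pt(2,3) by (simp add: prev_states_def)
  finally have "?c \<noteq> \<infinity>" by auto
  moreover have "0 \<le> ?c"
    using sol by (intro cost_nonneg[of 0]) (auto simp: nodes_0 prev_states_def is_arg_min_def)
  ultimately obtain c where c: "?c = ereal c" by (cases ?c) auto
  have "ereal eps < UB R j - LB R j" using iteration(1)[OF i] j(3) by simp
  then have "ereal eps < (ereal c + upQ R j 0 ?x) - (ereal c + ereal r)"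
    using UB by (auto simp: LB c r intro: less_le_trans ereal_minus_mono)
  then show ?thesis
    using j(3) r by (cases "upQ R j 0 ?x") (auto simp: stage_gap_def)
qed

text \<open>Take the last stage before \<open>T\<close> whose gap exceeds its threshold; the root
  qualifies, and beyond stage \<open>T - 1\<close> all gaps are 0.\<close>

lemma critical_stage:
  assumes i: "1 \<le> i" "i \<le> k" and g: "g 0 \<le> eps" "0 \<le> g T"
  obtains t where "t < T" "ereal (g t) < stage_gap i t"
    "\<And>n. n \<in> nodes P (Suc t) \<Longrightarrow> gap R i (Suc t) n \<le> ereal (g (Suc t))"
proof -
  define S where "S = {t. t < T \<and> ereal (g t) < stage_gap i t}"
  have "ereal (g 0) \<le> ereal eps" using g(1) by simp
  then have "0 \<in> S"
    using le_less_trans[OF _ root_gap[OF i]] horizon_pos by (simp add: S_def)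
  moreover have fin: "finite S" by (simp add: S_def)
  ultimately have "Max S \<in> S" by (intro Max_in) auto
  then have t: "Max S < T" "ereal (g (Max S)) < stage_gap i (Max S)" by (auto simp: S_def)
  show thesis
  proof (rule that[OF t])
    fix n assume n: "n \<in> nodes P (Suc (Max S))"
    show "gap R i (Suc (Max S)) n \<le> ereal (g (Suc (Max S)))"
    proof (cases "Suc (Max S) = T")
      case True
      then have "gap R i (Suc (Max S)) n = 0"
        using lowQ_horizon[of "i - 1"] upQ_horizon[of "i - 1"] i by (simp add: gap_def)
      then show ?thesis using g(2) True by simp
    next
      case False
      then have T: "Suc (Max S) < T" using t(1) by simp
      have "Suc (Max S) \<notin> S" using Max_ge[OF fin, of "Suc (Max S)"] by auto
      then have "stage_gap i (Suc (Max S)) \<le> ereal (g (Suc (Max S)))"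
        using T by (simp add: S_def)
      \<comment> \<open>The state comes from the node of largest gap, so bounding this one gap
        bounds those of all nodes of the stage.\<close>
      moreover have "stage_gap i (Suc (Max S)) = gap R i (Suc (Max S)) (sel R i (Suc (Max S)))"
        using selected(3)[OF i T] by (simp add: stage_gap_def gap_def)
      ultimately show ?thesis using selected(2)[OF i T n] by simp
    qed
  qed
qed

text \<open>The saturation reached in iteration \<open>i\<close> persists up to \<open>j - 1\<close>
  by monotonicity of the estimators; a state of iteration \<open>j\<close> too close to that of
  \<open>i\<close> would contradict its large gap.\<close>

lemma visited_states_separated:
  assumes ij: "1 \<le> i" "i < j" "j \<le> k" and t: "t < T"
    and gap_i: "\<And>n. n \<in> nodes P (Suc t) \<Longrightarrow> gap R i (Suc t) n \<le> ereal h"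
    and gap_j: "ereal (h + \<delta>) < stage_gap j t"
  shows "\<delta> < 2 * lip_const P t * \<nu> (stage_x R j t - stage_x R i t)"
proof -
  let ?x = "stage_x R j t" and ?e = "2 * lip_const P t * \<nu> (stage_x R j t - stage_x R i t)"
  have i: "i \<le> k" and j: "1 \<le> j" "i \<le> j - 1" "j - 1 \<le> k" using ij by auto
  have x: "?x \<in> states P t" by (rule stage_x_states[OF j(1) ij(3) t])
  obtain r where r: "lowQ R (j - 1) t ?x = ereal r" using lowQ_real[OF j(3), of t] t by auto
  have "upQ R (j - 1) t ?x \<le> upQ R i t ?x"
    using x states_subset[OF t] by (intro upQ_antimono[OF j(2,3) t]) blast
  also have "\<dots> \<le> lowQ R i t ?x + ereal (h + ?e)"
    by (rule saturation[OF ij(1) i t x gap_i])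
  also have "\<dots> \<le> lowQ R (j - 1) t ?x + ereal (h + ?e)"
    using lowQ_mono[OF j(2,3) t] by (rule add_right_mono)
  finally have "upQ R (j - 1) t ?x \<le> ereal (r + h + ?e)" unfolding r by (simp add: add.assoc)
  then have "stage_gap j t \<le> ereal (h + ?e)"
    unfolding stage_gap_def r by (cases "upQ R (j - 1) t ?x") auto
  with gap_j have "ereal (h + \<delta>) < ereal (h + ?e)" by (rule less_le_trans)
  then show ?thesis by simp
qed

lemma iteration_bound:
  assumes L: "\<And>t. t < T \<Longrightarrow> lip_const P t \<le> L"
    and d: "\<And>t. t < T \<Longrightarrow> state_dim P t \<le> d"
    and D: "\<And>t. t < T \<Longrightarrow> state_diam P t \<le> D"
    and eps: "0 < eps"
  shows "real k \<le> real T * (1 + 2 * L * D * real T / eps) ^ d"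
proof -
  define \<delta> where "\<delta> = eps / real T"
  have \<delta>: "0 < \<delta>" using eps horizon_pos by (simp add: \<delta>_def)
  have L0: "0 < L" using lip_const_pos[OF horizon_pos] L[OF horizon_pos] by simp
  \<comment> \<open>Each stage is allotted an equal share \<delta> of the tolerance, so
    \<open>g\<close> falls from \<open>eps\<close> at the root to 0 at stage
    \<open>T\<close>.\<close>
  define g where "g t = (real T - real t) * \<delta>" for t
  \<comment> \<open>The iterations charged to stage \<open>t\<close>; an iteration may belong to
    several of these sets, as only their union has to cover \<open>{1..k}\<close>.\<close>
  define I where "I t = {i \<in> {1..k}. ereal (g t) < stage_gap i t \<and>
    (\<forall>n\<in>nodes P (Suc t). gap R i (Suc t) n \<le> ereal (g (Suc t)))}" for t
  \<comment> \<open>Half the separation \<delta> \<open>/ (2 * L)\<close>, because the packing bound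
    is stated for distance \<open>2 * r\<close>.\<close>
  define r where "r = \<delta> / (4 * L)"
  have r: "0 < r" using \<delta> L0 by (simp add: r_def)
  have sub: "{1..k} \<subseteq> (\<Union>t<T. I t)"
  proof
    fix i assume "i \<in> {1..k}"
    then have i: "1 \<le> i" "i \<le> k" by auto
    have "g 0 \<le> eps" "0 \<le> g T" using horizon_pos by (auto simp: g_def \<delta>_def)
    then obtain t where "t < T" "ereal (g t) < stage_gap i t"
        "\<And>n. n \<in> nodes P (Suc t) \<Longrightarrow> gap R i (Suc t) n \<le> ereal (g (Suc t))"
      using critical_stage[OF i] by blast
    then show "i \<in> (\<Union>t<T. I t)" using i by (auto simp: I_def)
  qed
  have card_I: "real (card (I t)) \<le> (1 + 2 * L * D * real T / eps) ^ d" if t: "t < T" for t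
  proof -
    obtain m where m: "m \<in> nodes P t" using nodes_nonempty[of t] t by auto
    have "compact (fst ` feas P m)"
      using compact_feas[OF _ m] t by (intro compact_continuous_image continuous_intros) auto
    then have "compact (states P t)" using fst_feas[OF t m] by simp
    then have X: "bounded (states P t)" "states P t \<subseteq> coord_subspace (coords P t)"
      using states_subset[OF t] by (auto simp: compact_imp_bounded state_space_eq)
    have diam: "enclosing_diameter (coord_subspace (coords P t)) \<nu> (states P t) \<le> D"
      using D[OF t] by (simp add: state_diam_def state_space_eq)
    then have D0: "0 \<le> D" using enclosing_diameter_nonneg[OF is_norm X] by simp
    \<comment> \<open>The later iteration sees the cuts of the earlier one, so \<open>i < j\<close>
      is assumed; symmetry of the norm removes this below.\<close>
    have sep: "2 * r \<le> \<nu> (stage_x R j t - stage_x R i t)" if "i \<in> I t" "j \<in> I t" "i < j" for i j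
    proof -
      have "g t = g (Suc t) + \<delta>" by (simp add: g_def algebra_simps)
      then have "\<delta> < 2 * lip_const P t * \<nu> (stage_x R j t - stage_x R i t)"
        using that by (intro visited_states_separated[OF _ _ _ t, where h = "g (Suc t)"])
          (auto simp: I_def)
      also have "\<dots> \<le> 2 * L * \<nu> (stage_x R j t - stage_x R i t)"
        using L[OF t] nonneg_norm by (intro mult_right_mono) auto
      finally show ?thesis using L0 by (simp add: r_def field_simps)
    qed
    have "real (card (I t)) \<le> (1 + D / (2 * r)) ^ card (coords P t)"
    proof (rule enclosing_diameter_packing_bound[OF is_norm _ r X _ _ diam])
      fix i j assume ij: "i \<in> I t" "j \<in> I t" "i \<noteq> j"
      then show "2 * r \<le> \<nu> (stage_x R i t - stage_x R j t)"
        using sep[of i j] sep[of j i] is_norm_minus_commute[OF is_norm]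
        by (metis linorder_neqE_nat)
    qed (use t in \<open>auto simp: I_def intro: stage_x_states\<close>)
    also have "D / (2 * r) = 2 * L * D * real T / eps"
      using eps L0 horizon_pos by (simp add: r_def \<delta>_def field_simps)
    \<comment> \<open>The base is at least 1, so the exponent may be raised to
      \<open>d\<close>.\<close>
    also have "(1 + 2 * L * D * real T / eps) ^ card (coords P t)
        \<le> (1 + 2 * L * D * real T / eps) ^ d"
      using d[OF t] D0 L0 eps by (intro power_increasing) (auto simp: state_dim_def)
    finally show ?thesis .
  qed
  have "k = card {1..k}" by simp
  also have "\<dots> \<le> card (\<Union>t<T. I t)" by (rule card_mono[OF _ sub]) (simp add: I_def)
  also have "\<dots> \<le> (\<Sum>t<T. card (I t))" by (rule card_UN_le) simp
  finally have "real k \<le> (\<Sum>t<T. real (card (I t)))" by (metis of_nat_mono of_nat_sum)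
  also have "\<dots> \<le> (\<Sum>t<T. (1 + 2 * L * D * real T / eps) ^ d)"
    by (intro sum_mono card_I) simp
  finally show ?thesis by simp
qed

end

theorem corollary1:
  fixes P :: "('m, 'n::finite, 'y::euclidean_space) msp"
    and R :: "('m, 'n, 'y) run"
    and L D eps :: real and d i :: nat
  assumes "valid_problem P"
    and "feasible_finite P"
    and "valid_regularization P"
    and "exact_regularization P"
    and "valid_dual_bounds P"
    and "\<forall>t<horizon P. lip_const P t \<le> L"
    and "\<forall>t<horizon P. state_dim P t \<le> d"
    and "\<forall>t<horizon P. state_diam P t \<le> D"
    and "0 < eps"
    and "terminates_at P eps R i"
    and "eps_optimal_root P eps (best R i)"
  shows "real i \<le> real (horizon P) * (1 + 2 * L * D * real (horizon P) / eps) ^ d"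
proof -
  interpret algorithm_run P R eps i
    using assms by unfold_locales
  show ?thesis using assms by (intro iteration_bound) auto
qed

end
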